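(* Let $p\in(0,1)$ be a fixed constant and let $\alpha,\beta\ge 0$ be fixed real numbers. For an even integer $n=2s$, let $M$ be the $n\times n$ matrix with $m_{ij}=p$ if $1\le|i-j|\le s-1$ and $0$ otherwise, and let $\widehat M$ be a random symmetric $n\times n$ matrix with zero diagonal whose entries $\widehat m_{ij}$, $i<j$, are independent Bernoulli variables with $\mathbb P(\widehat m_{ij}=1)=m_{ij}$. Let $u\in\mathbb R^n$ be given by $u_j=\cos\left(\frac{(2j-1)\pi}{4s+2}\right)$ for $j=1,\dots,s$ and $u_j=-u_{n-j+1}$ for $j=s+1,\dots,n$, and let $y$ be a unit eigenvector of $\widehat M$ for $\lambda_2(\widehat M)$ with sign chosen so that $\langle y,u\rangle\ge0$. Let $r=n^{\alpha}$ and $k=n^{\beta}$. Then there is a constant $C>0$ (independent of $n$) such that, with probability at least $1-n^{-3}$: if $\alpha\le\beta$ then $D_{k,r}(y)<Cn^{5-2(\alpha+\beta)}$, and if $\alpha>\beta$ then $D_{k,r}(y)<Cn^{5-4\beta}$.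
   Context: Eigenvalues of a symmetric matrix $X$ are labelled so that $|\lambda_1(X)|\ge|\lambda_2(X)|\ge\dots$; $\lambda_2(X)$ is the one of second largest absolute value. For a vector $y\in\mathbb R^n$ and reals $k,r$, the refined Kendall distance is \[ D_{k,r}(y)=\left|\{(i,j): y_j>y_i,\ i+k\le j,\ r\le i\}\right|, \] i.e. the number of pairs of indices at least $k$ apart, with the smaller index at least $r$, that are out of the (decreasing) order. *)

theory Defs
  imports "HOL-Probability.Product_PMF" "Jordan_Normal_Form.Char_Poly"
begin

(* All vectors/matrices below are 0-indexed in Isabelle; the paper's index j (1..n)
   corresponds to Isabelle index j-1. *)

definition band_prob :: "real \<Rightarrow> nat \<Rightarrow> nat \<Rightarrow> nat \<Rightarrow> real" where
  "band_prob p s i j = (if 1 \<le> nat \<bar>int i - int j\<bar> \<and> nat \<bar>int i - int j\<bar> \<le> s - 1 then p else 0)"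

definition upper_pairs :: "nat \<Rightarrow> (nat \<times> nat) set" where
  "upper_pairs n = {(i, j). i < j \<and> j < n}"

definition entries_pmf :: "real \<Rightarrow> nat \<Rightarrow> (nat \<times> nat \<Rightarrow> bool) pmf" where
  "entries_pmf p s = Pi_pmf (upper_pairs (2 * s)) False
      (\<lambda>(i, j). bernoulli_pmf (band_prob p s i j))"

definition sym_matrix :: "nat \<Rightarrow> (nat \<times> nat \<Rightarrow> bool) \<Rightarrow> real mat" where
  "sym_matrix n b = mat n n (\<lambda>(i, j).
      if i < j then (if b (i, j) then 1 else 0)
      else if j < i then (if b (j, i) then 1 else 0) else 0)"

(* \<mu> is (a possible value of) \<lambda>_2(A): listing the eigenvalues of A with
   (algebraic) multiplicity as \<lambda>_1, ..., \<lambda>_n with |\<lambda>_1| \<ge> |\<lambda>_2| \<ge> ...,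
   \<mu> is the second one. *)
definition is_lambda2 :: "real mat \<Rightarrow> real \<Rightarrow> bool" where
  "is_lambda2 A \<mu> = (\<exists>ls. char_poly A = (\<Prod>a\<leftarrow>ls. [:-a, 1:]) \<and>
      sorted_wrt (\<lambda>a b. \<bar>a\<bar> \<ge> \<bar>b\<bar>) ls \<and> 2 \<le> length ls \<and> ls ! 1 = \<mu>)"

definition u_vec :: "nat \<Rightarrow> real vec" where
  "u_vec s = vec (2 * s) (\<lambda>i. let j = i + 1 in
      if j \<le> s then cos ((2 * real j - 1) * pi / (4 * real s + 2))
      else - cos ((2 * real (2 * s - j + 1) - 1) * pi / (4 * real s + 2)))"

definition kendall_refined :: "real \<Rightarrow> real \<Rightarrow> real vec \<Rightarrow> nat" where
  "kendall_refined k r y = card {(i, j). i \<in> {1..dim_vec y} \<and> j \<in> {1..dim_vec y} \<and>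
      y $ (j - 1) > y $ (i - 1) \<and> real i + k \<le> real j \<and> r \<le> real i}"

end

theory Submission
  imports Defs "HOL-Probability.Hoeffding"
begin

text \<open>
  Write \<open>M\<close> for the mean matrix, \<open>E\<close> for the centred noise and \<open>v\<close> for the unit vector along \<open>u\<close>.
  Hoeffding's inequality and a lattice net give \<open>\<parallel>E\<parallel> = O(sqrt n)\<close> up to probability \<open>n ^ -3\<close>. The vector
  \<open>u\<close> is an exact eigenvector of \<open>M\<close>; a Rayleigh quotient for the largest eigenvalue and the
  Frobenius norm of \<open>M\<close> separate its eigenvalue from all others by a multiple of \<open>n\<close>, also after
  adding \<open>E\<close>. Hence \<open>\<parallel>y - v\<parallel>\<^sup>2 = O(1 / n)\<close>. If the indices \<open>i < j\<close> are at least \<open>k\<close> apart, then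
  \<open>u\<^sub>i - u\<^sub>j \<ge> k\<^sup>2 / (2 * n\<^sup>2)\<close>, so every inversion of \<open>y\<close> contains an index at which \<open>y - v\<close> is
  of order \<open>k\<^sup>2 / n powr (5 / 2)\<close>; there are \<open>O(n ^ 4 / k ^ 4)\<close> of these and \<open>O(n ^ 5 / k ^ 4)\<close>
  inversions. This is the bound for \<open>\<alpha> > \<beta>\<close>, and it is stronger than the one for \<open>\<alpha> \<le> \<beta>\<close>.
\<close>

section \<open>Diagonalization of real symmetric matrices\<close>

text \<open>The Householder reflection along \<open>w\<close>, the difference of \<open>f\<close>
  and the first unit vector, exchanges these two vectors, so that its first column is
  \<open>f\<close>.\<close>

lemma reflection_onto_unit_vector:
  fixes f :: "nat \<Rightarrow> real"
  assumes f: "(\<Sum>i<Suc m. (f i)\<^sup>2) = 1"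
  obtains H :: "real mat" where
    "H \<in> carrier_mat (Suc m) (Suc m)" "transpose_mat H = H" "H * H = 1\<^sub>m (Suc m)"
    "\<And>i. i < Suc m \<Longrightarrow> H $$ (i, 0) = f i"
proof -
  define w where "w i = f i - (if i = 0 then 1 else 0)" for i :: nat
  define W where "W = (\<Sum>i<Suc m. (w i)\<^sup>2)"
  \<comment> \<open>If \<open>f\<close> is the first unit vector, then \<open>W = 0\<close> and
    division by zero gives \<open>c = 0\<close>: \<open>H\<close> is the identity, and
    \<open>cW\<close> holds in this case too.\<close>
  define c where "c = 2 / W"
  have cW: "c\<^sup>2 * W = 2 * c"
    unfolding c_def by (auto simp: power2_eq_square)
  define H where "H = mat (Suc m) (Suc m) (\<lambda>(i, j). (if i = j then 1 else 0) - c * w i * w j)"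
  have W: "W = 2 - 2 * f 0"
  proof -
    have "(\<Sum>i<Suc m. (w i)\<^sup>2) = (\<Sum>i<Suc m. (f i)\<^sup>2 + (if i = 0 then 1 - 2 * f 0 else 0))"
      by (intro sum.cong) (auto simp: w_def power2_eq_square algebra_simps)
    also have "\<dots> = 1 + (1 - 2 * f 0)"
      unfolding sum.distrib f by simp
    finally show ?thesis by (simp add: W_def)
  qed
  show ?thesis
  proof (rule that[of H])
    show "H \<in> carrier_mat (Suc m) (Suc m)" "transpose_mat H = H"
      by (auto simp: H_def intro!: eq_matI)
    show "H * H = 1\<^sub>m (Suc m)"
    proof (rule eq_matI)
      fix i j assume "i < dim_row (1\<^sub>m (Suc m) :: real mat)" "j < dim_col (1\<^sub>m (Suc m) :: real mat)"
      hence ij: "i < Suc m" "j < Suc m" by auto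
      have "(H * H) $$ (i, j) = (\<Sum>k<Suc m. ((if i = k then 1 else 0) - c * w i * w k)
            * ((if k = j then 1 else 0) - c * w k * w j))"
        using ij by (simp add: H_def scalar_prod_def atLeast0LessThan)
      also have "\<dots> = (\<Sum>k<Suc m. (if i = k then (if k = j then 1 else 0) else 0)
          - (if i = k then c * w k * w j else 0) - (if k = j then c * w i * w k else 0)
          + c\<^sup>2 * w i * w j * (w k)\<^sup>2)"
        by (intro sum.cong) (auto simp: algebra_simps power2_eq_square)
      also have "\<dots> = (if i = j then 1 else 0) - c * w i * w j - c * w i * w j
          + c\<^sup>2 * w i * w j * W"
        using ij unfolding sum.distrib sum_subtractf W_def sum_distrib_left
        by (simp del: sum.lessThan_Suc)
      also have "\<dots> = (if i = j then 1 else 0) - 2 * (c * w i * w j) + (c\<^sup>2 * W) * (w i * w j)"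
        by (simp add: algebra_simps)
      also have "\<dots> = (if i = j then 1 else 0)"
        unfolding cW by simp
      finally show "(H * H) $$ (i, j) = 1\<^sub>m (Suc m) $$ (i, j)"
        using ij by simp
    qed (simp_all add: H_def)
    fix i assume i: "i < Suc m"
    show "H $$ (i, 0) = f i"
    proof (cases "W = 0")
      case True
      hence "w i = 0" using i
        unfolding W_def by (subst (asm) sum_nonneg_eq_0_iff) auto
      with True i show ?thesis by (auto simp: H_def c_def w_def split: if_splits)
    next
      case False
      have "c * w 0 = -1"
        using False unfolding c_def by (simp add: w_def W field_simps)
      hence "c * w i * w 0 = - w i"
        by (metis mult.commute mult.left_commute mult_minus1_right)
      thus ?thesis using i by (auto simp: H_def w_def)
    qed
  qed
qed

text \<open>By symmetry the first row vanishes off the diagonal together with the first column. This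
  is the deflation step of the diagonalization.\<close>

lemma symmetric_first_column_four_block:
  fixes B :: "real mat"
  assumes B: "B \<in> carrier_mat (Suc m) (Suc m)" "transpose_mat B = B"
    and col: "\<And>i. i < Suc m \<Longrightarrow> B $$ (i, 0) = (if i = 0 then e else 0)"
  obtains D where "D \<in> carrier_mat m m" "transpose_mat D = D"
    "B = four_block_mat (mat 1 1 (\<lambda>_. e)) (0\<^sub>m 1 m) (0\<^sub>m m 1) D"
proof
  have sym: "B $$ (i, j) = B $$ (j, i)" if "i < Suc m" "j < Suc m" for i j
    using B that by (metis carrier_matD index_transpose_mat(1))
  let ?D = "mat m m (\<lambda>(i, j). B $$ (Suc i, Suc j))"
  show "?D \<in> carrier_mat m m" by simp
  show "transpose_mat ?D = ?D"
    by (rule eq_matI) (auto intro: sym)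
  show "B = four_block_mat (mat 1 1 (\<lambda>_. e)) (0\<^sub>m 1 m) (0\<^sub>m m 1) ?D"
  proof (rule eq_matI)
    fix i j
    assume "i < dim_row (four_block_mat (mat 1 1 (\<lambda>_. e)) (0\<^sub>m 1 m) (0\<^sub>m m 1) ?D)"
      "j < dim_col (four_block_mat (mat 1 1 (\<lambda>_. e)) (0\<^sub>m 1 m) (0\<^sub>m m 1) ?D)"
    hence ij: "i < Suc m" "j < Suc m" by auto
    thus "B $$ (i, j) = four_block_mat (mat 1 1 (\<lambda>_. e)) (0\<^sub>m 1 m) (0\<^sub>m m 1) ?D $$ (i, j)"
      using col[of i] col[of j] sym[of i j] by auto
  qed (use B in auto)
qed

text \<open>Deflation, one root at a time. The diagonal follows the order of the given list
  \<open>es\<close>, so a list sorted by modulus keeps its second eigenvalue at index 1.\<close>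

lemma real_symmetric_diagonalizable:
  fixes A :: "real mat"
  assumes "A \<in> carrier_mat n n" "transpose_mat A = A" "char_poly A = (\<Prod>a\<leftarrow>es. [:-a, 1:])"
  shows "\<exists>U. U \<in> carrier_mat n n \<and> transpose_mat U * U = 1\<^sub>m n \<and> U * transpose_mat U = 1\<^sub>m n \<and>
    A * U = U * mat n n (\<lambda>(i, j). if i = j then es ! i else 0)"
  using assms
proof (induction es arbitrary: n A)
  case Nil
  have "n = 0" using degree_monic_char_poly[OF Nil.prems(1)] Nil.prems(3) by auto
  thus ?case using Nil.prems by (intro exI[of _ "1\<^sub>m 0"]) auto
next
  case (Cons e es n A)
  note A = Cons.prems(1) and symA = Cons.prems(2) and cpA = Cons.prems(3)
  have "degree (char_poly A) = Suc (length es)"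
    unfolding cpA using degree_linear_factors[of uminus "e # es"] by simp
  with degree_monic_char_poly[OF A] have "n = Suc (length es)" by simp
  then obtain m where n: "n = Suc m" by blast
  have "eigenvalue A e"
    unfolding eigenvalue_root_char_poly[OF A] cpA by (simp add: poly_prod_list)
  then obtain v where v: "v \<in> carrier_vec n" "v \<noteq> 0\<^sub>v n" "A *\<^sub>v v = e \<cdot>\<^sub>v v"
    using A unfolding eigenvalue_def eigenvector_def by auto
  define N where "N = (\<Sum>i<Suc m. (v $ i)\<^sup>2)"
  have "N \<noteq> 0"
  proof
    assume "N = 0"
    hence "\<forall>i<Suc m. v $ i = 0"
      unfolding N_def by (subst (asm) sum_nonneg_eq_0_iff) auto
    hence "v = 0\<^sub>v n" using v(1) by (intro eq_vecI) (auto simp: n)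
    with v(2) show False ..
  qed
  moreover have "N \<ge> 0" unfolding N_def by (intro sum_nonneg) auto
  ultimately have N: "N > 0" by simp
  define f where "f i = v $ i / sqrt N" for i
  have f: "(\<Sum>i<Suc m. (f i)\<^sup>2) = 1"
    using N by (simp add: f_def power_divide sum_divide_distrib[symmetric] N_def del: sum.lessThan_Suc)
  obtain H where H: "H \<in> carrier_mat n n" "transpose_mat H = H" "H * H = 1\<^sub>m n"
    "\<And>i. i < n \<Longrightarrow> H $$ (i, 0) = f i"
    using reflection_onto_unit_vector[OF f] n by metis
  define fv where "fv = vec n f"
  have fv: "fv \<in> carrier_vec n" by (simp add: fv_def)
  have fv_alt: "fv = (1 / sqrt N) \<cdot>\<^sub>v v"
    using v(1) by (intro eq_vecI) (auto simp: fv_def f_def)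
  have Afv: "A *\<^sub>v fv = e \<cdot>\<^sub>v fv"
    unfolding fv_alt using A v by (simp add: mult_mat_vec smult_smult_assoc mult.commute)
  have colH: "col H 0 = fv"
    using H by (intro eq_vecI) (auto simp: fv_def n)
  have Hfv: "H *\<^sub>v fv = unit_vec n 0"
  proof -
    have "col (H * H) 0 = H *\<^sub>v fv"
      unfolding colH[symmetric] by (rule col_mult2[OF H(1) H(1)]) (simp add: n)
    hence "H *\<^sub>v fv = col (H * H) 0" ..
    thus ?thesis using H n by (simp)
  qed
  \<comment> \<open>\<open>H\<close> is an involution that carries the unit eigenvector
    \<open>fv\<close> to the first coordinate axis, so conjugation by it splits off \<open>e\<close>
    and leaves a block with the remaining roots.\<close>
  define B where "B = H * (A * H)"
  have AH: "A * H \<in> carrier_mat n n" using A H by auto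
  have B: "B \<in> carrier_mat n n" unfolding B_def using A H by auto
  have symB: "transpose_mat B = B"
    using A H symA unfolding B_def
    by (simp add: transpose_mult[OF H(1) AH] transpose_mult[OF A H(1)] assoc_mult_mat[of _ n n _ n _ n])
  have "col B 0 = H *\<^sub>v (A *\<^sub>v fv)"
    unfolding B_def colH[symmetric] using n
    by (subst col_mult2[OF H(1) AH]; (subst col_mult2[OF A H(1)])?) auto
  also have "\<dots> = e \<cdot>\<^sub>v unit_vec n 0"
    unfolding Afv using H fv by (simp add: mult_mat_vec Hfv)
  finally have colB: "col B 0 = e \<cdot>\<^sub>v unit_vec n 0" .
  have "B $$ (i, 0) = (if i = 0 then e else 0)" if "i < Suc m" for i
  proof -
    have "B $$ (i, 0) = col B 0 $ i" using that B n by simp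
    thus ?thesis unfolding colB using that n by simp
  qed
  then obtain D where D: "D \<in> carrier_mat m m" "transpose_mat D = D"
    "B = four_block_mat (mat 1 1 (\<lambda>_. e)) (0\<^sub>m 1 m) (0\<^sub>m m 1) D"
    using symmetric_first_column_four_block[of B m e] B symB n by metis
  have HH: "H * (H * X) = X" if "X \<in> carrier_mat n n" for X
    using that H by (simp flip: assoc_mult_mat[of _ n n _ n _ n])
  have A_eq: "A = H * B * H"
    unfolding B_def using A H by (simp add: assoc_mult_mat[of _ n n _ n _ n] HH)
  have "similar_mat A B"
    by (rule similar_matI[of _ _ H H n]) (use A B H A_eq in auto)
  hence "char_poly A = char_poly B" by (rule char_poly_similar)
  also have "\<dots> = char_poly (mat 1 1 (\<lambda>_. e) :: real mat) * char_poly D"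
    unfolding D(3) using D(1) by (intro char_poly_four_block_zeros_col) auto
  also have "char_poly (mat 1 1 (\<lambda>_. e) :: real mat) = [:-e, 1:]"
    by (subst char_poly_upper_triangular[of _ 1]) (auto simp: diag_mat_def)
  finally have "[:-e, 1:] * char_poly D = [:-e, 1:] * (\<Prod>a\<leftarrow>es. [:-a, 1:])"
    using cpA by simp
  hence "char_poly D = (\<Prod>a\<leftarrow>es. [:-a, 1:])"
    by (subst (asm) mult_left_cancel) auto
  from Cons.IH[OF D(1,2) this] obtain V where V: "V \<in> carrier_mat m m"
    "transpose_mat V * V = 1\<^sub>m m" "V * transpose_mat V = 1\<^sub>m m"
    "D * V = V * mat m m (\<lambda>(i, j). if i = j then es ! i else 0)" by blast
  define W where "W = four_block_mat (1\<^sub>m 1) (0\<^sub>m 1 m) (0\<^sub>m m 1) V"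
  have W: "W \<in> carrier_mat n n" unfolding W_def n using V by auto
  have Wt: "transpose_mat W = four_block_mat (1\<^sub>m 1) (0\<^sub>m 1 m) (0\<^sub>m m 1) (transpose_mat V)"
    unfolding W_def using V by (subst transpose_four_block_mat[of _ 1 1 _ m _ m]) auto
  have WtW: "transpose_mat W * W = 1\<^sub>m n"
    unfolding Wt unfolding W_def using V n
    by (subst mult_four_block_mat[of _ 1 1 _ m _ m _ _ 1 _ m])  auto
  have WWt: "W * transpose_mat W = 1\<^sub>m n"
    unfolding Wt unfolding W_def using V n
    by (subst mult_four_block_mat[of _ 1 1 _ m _ m _ _ 1 _ m]) auto
  let ?E = "mat n n (\<lambda>(i, j). if i = j then (e # es) ! i else 0)"
  let ?E' = "mat m m (\<lambda>(i, j). if i = j then es ! i else 0)"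
  have E: "?E = four_block_mat (mat 1 1 (\<lambda>_. e)) (0\<^sub>m 1 m) (0\<^sub>m m 1) ?E'"
    by (rule eq_matI) (auto simp: n)
  have BW: "B * W = W * ?E"
  proof -
    have "B * W = four_block_mat (mat 1 1 (\<lambda>_. e)) (0\<^sub>m 1 m) (0\<^sub>m m 1) (D * V)"
      unfolding D(3) W_def using V D
      by (subst mult_four_block_mat[of _ 1 1 _ m _ m _ _ 1 _ m]) auto
    also have "\<dots> = W * ?E"
      unfolding E W_def V(4) using V
      by (subst mult_four_block_mat[of _ 1 1 _ m _ m _ _ 1 _ m]) auto
    finally show ?thesis .
  qed
  define U where "U = H * W"
  have U: "U \<in> carrier_mat n n" unfolding U_def using H W by auto
  have Ut: "transpose_mat U = transpose_mat W * H"
    unfolding U_def using H W by (simp add: transpose_mult[OF H(1) W])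
  have 1: "transpose_mat U * U = 1\<^sub>m n"
    unfolding Ut unfolding U_def using H W WtW by (simp add: assoc_mult_mat[of _ n n _ n _ n] HH)
  have 2: "U * transpose_mat U = 1\<^sub>m n"
    unfolding Ut unfolding U_def using H W WWt
    by (simp add: assoc_mult_mat[of _ n n _ n _ n] flip: assoc_mult_mat[of W n n "transpose_mat W" n H n])
  have "A * U = H * (B * W)"
    unfolding A_eq U_def using H W B by (simp add: assoc_mult_mat[of _ n n _ n _ n] HH)
  also have "\<dots> = U * ?E"
    unfolding BW U_def using H W by (simp add: assoc_mult_mat[of _ n n _ n _ n])
  finally show ?case using U 1 2 by blast
qed

section \<open>Bilinear forms and a lattice net of the Euclidean ball\<close>

definition bilin :: "nat \<Rightarrow> (nat \<Rightarrow> nat \<Rightarrow> real) \<Rightarrow> (nat \<Rightarrow> real) \<Rightarrow> (nat \<Rightarrow> real) \<Rightarrow> real" where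
  "bilin n E x y = (\<Sum>i<n. \<Sum>j<n. x i * E i j * y j)"

definition sqnorm :: "nat \<Rightarrow> (nat \<Rightarrow> real) \<Rightarrow> real" where
  "sqnorm n x = (\<Sum>i<n. (x i)\<^sup>2)"

lemma sqnorm_nonneg [simp]: "0 \<le> sqnorm n x"
  by (simp add: sqnorm_def sum_nonneg)

lemma sqnorm_scale: "sqnorm n (\<lambda>i. c * x i) = c\<^sup>2 * sqnorm n x"
  by (simp add: sqnorm_def power_mult_distrib sum_distrib_left)

lemma bilin_scale: "bilin n E (\<lambda>i. c * x i) (\<lambda>i. d * y i) = c * d * bilin n E x y"
  by (simp add: bilin_def sum_distrib_left mult_ac)

lemma sum_mult_le_sqrt_sqnorm: "\<bar>\<Sum>i<n. x i * y i\<bar> \<le> sqrt (sqnorm n x) * sqrt (sqnorm n y)"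
  unfolding sqnorm_def using Cauchy_Schwarz_ineq_sum[of x y "{..<n}"]
  by (metis real_sqrt_abs real_sqrt_le_iff real_sqrt_mult)

text \<open>A crude bound; it makes the supremum of the form over the unit ball finite.\<close>

lemma bilin_bounded:
  assumes "sqnorm n x \<le> 1" "sqnorm n y \<le> 1"
  shows "\<bar>bilin n E x y\<bar> \<le> (\<Sum>i<n. \<Sum>j<n. \<bar>E i j\<bar>)"
proof -
  have *: "\<bar>z i\<bar> \<le> 1" if "sqnorm n z \<le> 1" "i < n" for z i
  proof -
    have "(z i)\<^sup>2 \<le> sqnorm n z"
      unfolding sqnorm_def using that(2) by (intro member_le_sum) auto
    thus ?thesis using that(1) abs_square_le_1 by fastforce
  qed
  have "\<bar>bilin n E x y\<bar> \<le> (\<Sum>i<n. \<Sum>j<n. \<bar>x i * E i j * y j\<bar>)"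
    unfolding bilin_def by (rule order_trans[OF sum_abs], intro sum_mono sum_abs)
  also have "\<dots> \<le> (\<Sum>i<n. \<Sum>j<n. \<bar>E i j\<bar>)"
  proof (intro sum_mono)
    fix i j assume "i \<in> {..<n}" "j \<in> {..<n}"
    hence "\<bar>x i\<bar> * \<bar>E i j\<bar> * \<bar>y j\<bar> \<le> 1 * \<bar>E i j\<bar> * 1"
      using *[OF assms(1)] *[OF assms(2)] by (intro mult_mono) auto
    thus "\<bar>x i * E i j * y j\<bar> \<le> \<bar>E i j\<bar>" by (simp add: abs_mult)
  qed
  finally show ?thesis .
qed

text \<open>Scaled by \<open>lattice_vec\<close>, these are the points of a cubic lattice with mesh
  \<open>1 / (4 * sqrt n)\<close> in the unit ball. The box places them in a finite product
  set.\<close>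

definition lattice_ball :: "nat \<Rightarrow> (nat \<Rightarrow> int) set" where
  "lattice_ball n = {z \<in> {..<n} \<rightarrow>\<^sub>E {-int (16 * n)..int (16 * n)}. (\<Sum>i<n. (z i)\<^sup>2) \<le> int (16 * n)}"

definition lattice_vec :: "nat \<Rightarrow> (nat \<Rightarrow> int) \<Rightarrow> nat \<Rightarrow> real" where
  "lattice_vec n z i = real_of_int (z i) / (4 * sqrt (real n))"

lemma finite_lattice_ball: "finite (lattice_ball n)"
  unfolding lattice_ball_def by (rule finite_subset[of _ "{..<n} \<rightarrow>\<^sub>E {-int (16 * n)..int (16 * n)}"])
    (auto intro: finite_PiE)

lemma sum_half_powers_int: "(\<Sum>z\<in>{-int m..int m}. (1/2::real) ^ nat \<bar>z\<bar>) \<le> 3"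
proof -
  have "(\<Sum>z\<in>{-int m..int m}. (1/2::real) ^ nat \<bar>z\<bar>) = 3 - 2 * (1/2) ^ m"
  proof (induction m)
    case (Suc m)
    have "{-int (Suc m)..int (Suc m)} = insert (int (Suc m)) (insert (-int (Suc m)) {-int m..int m})"
      by auto
    also have "(\<Sum>z\<in>\<dots>. (1/2::real) ^ nat \<bar>z\<bar>) = 2 * (1/2) ^ Suc m + (\<Sum>z\<in>{-int m..int m}. (1/2::real) ^ nat \<bar>z\<bar>)"
      by (subst sum.insert; (subst sum.insert)?) (auto simp: nat_add_distrib)
    finally show ?case unfolding Suc by simp
  qed simp
  thus ?thesis by simp
qed

text \<open>Each lattice point \<open>z\<close> is charged the weight \<open>2 ^ (16 * n - \<Sum>i<n. (z i)\<^sup>2) \<ge> 1\<close>, and the sum of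
  all weights factors over the coordinates.\<close>

lemma card_lattice_ball: "real (card (lattice_ball n)) \<le> 2 ^ (18 * n)"
proof -
  let ?I = "{-int (16 * n)..int (16 * n)}"
  have "real (card (lattice_ball n)) = (\<Sum>z\<in>lattice_ball n. 1)"
    by simp
  also have "\<dots> \<le> (\<Sum>z\<in>lattice_ball n. 2 ^ (16 * n) * (\<Prod>i<n. (1/2) ^ nat \<bar>z i\<bar>))"
  proof (rule sum_mono)
    fix z assume z: "z \<in> lattice_ball n"
    \<comment> \<open>Integers satisfy \<open>\<bar>z\<bar> \<le> z * z\<close>, so the weight with
      exponents \<open>\<bar>z i\<bar>\<close> is still at least 1, while each of its factors now
      sums to a geometric series.\<close>
    have "int (\<Sum>i<n. nat \<bar>z i\<bar>) \<le> (\<Sum>i<n. (z i)\<^sup>2)"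
      unfolding of_nat_sum
    proof (rule sum_mono)
      fix i
      have "\<bar>z i\<bar> * 1 \<le> \<bar>z i\<bar> * \<bar>z i\<bar>" if "z i \<noteq> 0" using that by (intro mult_left_mono) auto
      thus "int (nat \<bar>z i\<bar>) \<le> (z i)\<^sup>2" by (cases "z i = 0") (auto simp: power2_eq_square)
    qed
    also have "\<dots> \<le> int (16 * n)" using z by (simp add: lattice_ball_def)
    finally have "(\<Sum>i<n. nat \<bar>z i\<bar>) \<le> 16 * n" by (simp only: of_nat_le_iff)
    hence "(1/2::real) ^ (16 * n) \<le> (1/2) ^ (\<Sum>i<n. nat \<bar>z i\<bar>)"
      by (intro power_decreasing) auto
    also have "\<dots> = (\<Prod>i<n. (1/2) ^ nat \<bar>z i\<bar>)"
      by (simp add: power_sum)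
    finally have "2 ^ (16 * n) * (1/2) ^ (16 * n) \<le> 2 ^ (16 * n) * (\<Prod>i<n. (1/2::real) ^ nat \<bar>z i\<bar>)"
      by (intro mult_left_mono) auto
    thus "1 \<le> 2 ^ (16 * n) * (\<Prod>i<n. (1/2::real) ^ nat \<bar>z i\<bar>)"
      by (simp only: power_mult_distrib[symmetric]) simp
  qed
  also have "\<dots> \<le> (\<Sum>z\<in>{..<n} \<rightarrow>\<^sub>E ?I. 2 ^ (16 * n) * (\<Prod>i<n. (1/2) ^ nat \<bar>z i\<bar>))"
    by (intro sum_mono2 finite_PiE mult_nonneg_nonneg prod_nonneg)
      (simp_all add: lattice_ball_def subset_iff)
  also have "\<dots> = 2 ^ (16 * n) * (\<Prod>i<n. \<Sum>z\<in>?I. (1/2) ^ nat \<bar>z\<bar>)"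
    using infsetsum_prod_PiE[of "{..<n}" "\<lambda>_. ?I" "\<lambda>_ z. (1/2::real) ^ nat \<bar>z\<bar>"]
    by (simp add: sum_distrib_left[symmetric] finite_PiE)
  also have "\<dots> \<le> 2 ^ (16 * n) * (\<Prod>i<n. 3)"
    by (intro mult_left_mono prod_mono conjI sum_half_powers_int sum_nonneg) auto
  also have "\<dots> \<le> 2 ^ (16 * n) * 4 ^ n"
    unfolding prod_constant card_lessThan by (intro mult_left_mono power_mono) simp_all
  also have "(4::real) ^ n = 2 ^ (2 * n)" by (simp add: power_mult)
  also have "2 ^ (16 * n) * 2 ^ (2 * n) = (2::real) ^ (18 * n)"
    unfolding power_add[symmetric] by (rule arg_cong[of _ _ "power 2"]) simp
  finally show ?thesis .
qed

lemma sqnorm_lattice_vec: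
  assumes "z \<in> lattice_ball n" "n > 0"
  shows "sqnorm n (lattice_vec n z) \<le> 1"
proof -
  have "sqnorm n (lattice_vec n z) = real_of_int (\<Sum>i<n. (z i)\<^sup>2) / (16 * real n)"
    by (simp add: sqnorm_def lattice_vec_def power_divide power_mult_distrib sum_divide_distrib)
  also have "(\<Sum>i<n. (z i)\<^sup>2) \<le> int (16 * n)" using assms by (simp add: lattice_ball_def)
  hence "real_of_int (\<Sum>i<n. (z i)\<^sup>2) / (16 * real n) \<le> real_of_int (int (16 * n)) / (16 * real n)"
    by (intro divide_right_mono of_int_le_iff[THEN iffD2]) auto
  finally show ?thesis using assms by simp
qed

text \<open>Rounding to the lattice changes each coordinate by at most its mesh, hence the squared
  norm of the error is at most \<open>n / (16 * n)\<close>.\<close>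

lemma lattice_ball_approx:
  assumes x: "sqnorm n x \<le> 1" and n: "n > 0"
  obtains z where "z \<in> lattice_ball n" "sqnorm n (\<lambda>i. x i - lattice_vec n z i) \<le> 1 / 16"
proof -
  let ?c = "4 * sqrt (real n)"
  have c: "?c > 0" using n by simp
  \<comment> \<open>Rounding towards zero does not leave the ball.\<close>
  define t where "t a = (if a \<ge> 0 then \<lfloor>a\<rfloor> else \<lceil>a\<rceil>)" for a :: real
  have t1: "\<bar>real_of_int (t a)\<bar> \<le> \<bar>a\<bar>" and t2: "\<bar>a - real_of_int (t a)\<bar> \<le> 1" for a
    unfolding t_def by (auto; linarith)+
  define z where "z = restrict (\<lambda>i. t (?c * x i)) {..<n}"
  have "real_of_int (\<Sum>i<n. (z i)\<^sup>2) \<le> (\<Sum>i<n. (?c * x i)\<^sup>2)"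
    unfolding of_int_sum of_int_power
  proof (rule sum_mono)
    fix i assume "i \<in> {..<n}"
    thus "(real_of_int (z i))\<^sup>2 \<le> (?c * x i)\<^sup>2"
      using t1[of "?c * x i"] by (simp add: z_def abs_le_square_iff)
  qed
  also have "\<dots> = 16 * real n * sqnorm n x"
    by (simp add: sqnorm_def power_mult_distrib sum_distrib_left)
  also have "\<dots> \<le> 16 * real n * 1" using x by (intro mult_left_mono) auto
  finally have sz: "(\<Sum>i<n. (z i)\<^sup>2) \<le> int (16 * n)" by linarith
  have "\<bar>z i\<bar> \<le> int (16 * n)" if "i < n" for i
  proof -
    have "\<bar>z i\<bar> \<le> (z i)\<^sup>2"
    proof (cases "z i = 0")
      case False
      hence "\<bar>z i\<bar> * 1 \<le> \<bar>z i\<bar> * \<bar>z i\<bar>" by (intro mult_left_mono) auto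
      thus ?thesis by (simp add: power2_eq_square)
    qed simp
    also have "\<dots> \<le> (\<Sum>i<n. (z i)\<^sup>2)" using that by (intro member_le_sum) auto
    finally show ?thesis using sz by simp
  qed
  hence "z \<in> lattice_ball n"
    unfolding lattice_ball_def using sz by (auto simp: z_def PiE_iff abs_le_iff)
      (smt (verit) lessThan_iff restrict_apply')+
  moreover have "sqnorm n (\<lambda>i. x i - lattice_vec n z i) \<le> (\<Sum>i<n. 1 / (16 * real n))"
    unfolding sqnorm_def
  proof (rule sum_mono)
    fix i assume i: "i \<in> {..<n}"
    have "x i - lattice_vec n z i = (?c * x i - t (?c * x i)) / ?c"
      using c i by (simp add: lattice_vec_def z_def field_simps)
    hence "(x i - lattice_vec n z i)\<^sup>2 = \<bar>?c * x i - t (?c * x i)\<bar>\<^sup>2 / (16 * real n)"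
      by (simp add: power_divide power_mult_distrib)
    also have "\<dots> \<le> 1\<^sup>2 / (16 * real n)"
      by (intro divide_right_mono power_mono t2) auto
    finally show "(x i - lattice_vec n z i)\<^sup>2 \<le> 1 / (16 * real n)" by simp
  qed
  hence "sqnorm n (\<lambda>i. x i - lattice_vec n z i) \<le> 1 / 16"
    using n by simp
  ultimately show ?thesis by (rule that)
qed

text \<open>Let \<open>S\<close> be the supremum of the form over the unit ball. Moving each of the
  two arguments to the net leaves an error vector of norm at most 1/4, which by homogeneity costs at
  most \<open>S / 4\<close>. So \<open>S \<le> Q + S / 2\<close>, and scaling extends
  \<open>S \<le> 2 * Q\<close> to all vectors.\<close>

lemma bilin_le_of_lattice:
  assumes net: "\<And>z w. z \<in> lattice_ball n \<Longrightarrow> w \<in> lattice_ball n \<Longrightarrow>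
      \<bar>bilin n E (lattice_vec n z) (lattice_vec n w)\<bar> \<le> Q"
  shows "\<bar>bilin n E x y\<bar> \<le> 2 * Q * sqrt (sqnorm n x) * sqrt (sqnorm n y)"
proof (cases "n = 0")
  case True
  thus ?thesis by (simp add: bilin_def sqnorm_def)
next
  case False
  hence n: "n > 0" by simp
  define B where "B = {p. sqnorm n (fst p) \<le> 1 \<and> sqnorm n (snd p) \<le> 1}"
  define S where "S = (SUP (x, y)\<in>B. \<bar>bilin n E x y\<bar>)"
  have bdd: "bdd_above ((\<lambda>(x, y). \<bar>bilin n E x y\<bar>) ` B)"
    unfolding B_def by (auto intro!: bdd_aboveI2[where M = "\<Sum>i<n. \<Sum>j<n. \<bar>E i j\<bar>"] bilin_bounded)
  have ne: "((\<lambda>_. 0), (\<lambda>_. 0)) \<in> B" by (simp add: B_def sqnorm_def)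
  have le_S: "\<bar>bilin n E x y\<bar> \<le> S" if "sqnorm n x \<le> 1" "sqnorm n y \<le> 1" for x y
    using cSUP_upper[OF _ bdd, of "(x, y)"] that by (simp add: S_def B_def)
  have "S \<ge> 0" using le_S[of "\<lambda>_. 0" "\<lambda>_. 0"] by (simp add: bilin_def sqnorm_def)
  have small: "\<bar>bilin n E x y\<bar> \<le> S / 4"
    if "sqnorm n x \<le> 1 / 16 \<and> sqnorm n y \<le> 1 \<or> sqnorm n x \<le> 1 \<and> sqnorm n y \<le> 1/16" for x y
  proof -
    from that consider "sqnorm n x \<le> 1 / 16" "sqnorm n y \<le> 1" | "sqnorm n x \<le> 1" "sqnorm n y \<le> 1/16" by blast
    thus ?thesis
    proof cases
      case 1
      have "\<bar>bilin n E (\<lambda>i. 4 * x i) (\<lambda>i. 1 * y i)\<bar> \<le> S"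
        by (intro le_S) (use 1 in \<open>simp_all add: sqnorm_scale del: mult_1\<close>)
      thus ?thesis unfolding bilin_scale by (simp add: abs_mult)
    next
      case 2
      have "\<bar>bilin n E (\<lambda>i. 1 * x i) (\<lambda>i. 4 * y i)\<bar> \<le> S"
        by (intro le_S) (use 2 in \<open>simp_all add: sqnorm_scale del: mult_1\<close>)
      thus ?thesis unfolding bilin_scale by (simp add: abs_mult)
    qed
  qed
  have "S \<le> Q + S / 4 + S / 4"
    unfolding S_def
  proof (rule cSUP_least)
    show "B \<noteq> {}" using ne by blast
    fix p assume "p \<in> B"
    then obtain x y where p: "p = (x, y)" and xy: "sqnorm n x \<le> 1" "sqnorm n y \<le> 1"
      by (cases p) (auto simp: B_def)
    obtain z where z: "z \<in> lattice_ball n" "sqnorm n (\<lambda>i. x i - lattice_vec n z i) \<le> 1 / 16"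
      using lattice_ball_approx[OF xy(1) n] .
    obtain w where w: "w \<in> lattice_ball n" "sqnorm n (\<lambda>i. y i - lattice_vec n w i) \<le> 1 / 16"
      using lattice_ball_approx[OF xy(2) n] .
    have "bilin n E x y = bilin n E (lattice_vec n z) (lattice_vec n w)
        + bilin n E (\<lambda>i. x i - lattice_vec n z i) y
        + bilin n E (lattice_vec n z) (\<lambda>i. y i - lattice_vec n w i)"
      by (simp add: bilin_def algebra_simps sum.distrib sum_subtractf)
    moreover have "\<bar>bilin n E (\<lambda>i. x i - lattice_vec n z i) y\<bar> \<le> S / 4"
      using z xy by (intro small) auto
    moreover have "\<bar>bilin n E (lattice_vec n z) (\<lambda>i. y i - lattice_vec n w i)\<bar> \<le> S / 4"
      using w sqnorm_lattice_vec[OF z(1) n] by (intro small) auto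
    moreover note net[OF z(1) w(1)]
    ultimately show "(case p of (x, y) \<Rightarrow> \<bar>bilin n E x y\<bar>)
        \<le> Q + (SUP (x, y)\<in>B. \<bar>bilin n E x y\<bar>) / 4 + (SUP (x, y)\<in>B. \<bar>bilin n E x y\<bar>) / 4"
      unfolding p S_def[symmetric] by simp
  qed
  hence SQ: "S \<le> 2 * Q" by simp
  show ?thesis
  proof (cases "sqnorm n x = 0 \<or> sqnorm n y = 0")
    case True
    hence "(\<forall>i<n. x i = 0) \<or> (\<forall>i<n. y i = 0)"
      unfolding sqnorm_def by (subst (asm) (1 2) sum_nonneg_eq_0_iff) auto
    hence "bilin n E x y = 0" by (auto simp: bilin_def)
    thus ?thesis using SQ \<open>S \<ge> 0\<close> by simp
  next
    case False
    hence pos: "sqnorm n x > 0" "sqnorm n y > 0"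
      using sqnorm_nonneg[of n x] sqnorm_nonneg[of n y] by linarith+
    have "\<bar>bilin n E (\<lambda>i. (1 / sqrt (sqnorm n x)) * x i) (\<lambda>i. (1 / sqrt (sqnorm n y)) * y i)\<bar> \<le> S"
      by (intro le_S) (use pos in \<open>simp_all only: sqnorm_scale, simp_all add: power_divide\<close>)
    hence "\<bar>bilin n E x y\<bar> \<le> S * (sqrt (sqnorm n x) * sqrt (sqnorm n y))"
      unfolding bilin_scale using pos by (simp add: abs_mult field_simps)
    also have "\<dots> \<le> 2 * Q * (sqrt (sqnorm n x) * sqrt (sqnorm n y))"
      using SQ by (intro mult_right_mono) auto
    finally show ?thesis by (simp add: mult_ac)
  qed
qed

section \<open>The noise matrix\<close>

text \<open>The union bound runs over at most \<open>2 ^ (36 * n)\<close> pairs of net points. Since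
  \<open>exp 1 \<ge> 2\<close>, the exponent 40 leaves four spare factors \<open>2 ^ n\<close>:
  three beat \<open>n ^ 3\<close> and one absorbs the 2 of the two-sided tail.\<close>

lemma exp_net_bound:
  assumes "n \<ge> 1"
  shows "(2 ^ (18 * n))\<^sup>2 * (2 * exp (- (40 * real n))) \<le> 1 / real n ^ 3"
proof -
  define a :: real where "a = 2 ^ n"
  have "2 ^ 1 \<le> a" unfolding a_def using assms by (intro power_increasing) auto
  hence a: "a \<ge> 2" by simp
  have an: "real n \<le> a" unfolding a_def using less_exp[of n]
    by (metis less_imp_le of_nat_le_iff of_nat_numeral of_nat_power)
  have pow: "2 ^ (k * n) = a ^ k" for k
    unfolding a_def by (simp only: power_mult[symmetric] mult.commute)
  have "a ^ 40 = 2 ^ (40 * n)" by (simp only: pow)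
  also have "\<dots> \<le> exp 1 ^ (40 * n)"
    using exp_ge_add_one_self[of 1] by (intro power_mono) auto
  also have "\<dots> = exp (40 * real n)"
    by (simp flip: exp_of_nat_mult)
  finally have "exp (- (40 * real n)) \<le> 1 / a ^ 40"
    using a by (simp add: exp_minus field_simps)
  hence "(2 ^ (18 * n))\<^sup>2 * (2 * exp (- (40 * real n))) \<le> (a ^ 18)\<^sup>2 * (2 * (1 / a ^ 40))"
    unfolding pow by (intro mult_left_mono) auto
  also have "\<dots> = (2 / a) * (1 / a ^ 3)"
    using a by (simp add: field_simps flip: power_mult power_add power_Suc)
  also have "\<dots> \<le> 1 * (1 / real n ^ 3)"
    using a an assms by (intro mult_mono divide_left_mono power_mono mult_pos_pos) auto
  finally show ?thesis by simp
qed

section \<open>Concentration of the bilinear form of the noise\<close>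

definition noise :: "real \<Rightarrow> nat \<Rightarrow> (nat \<times> nat \<Rightarrow> bool) \<Rightarrow> nat \<Rightarrow> nat \<Rightarrow> real" where
  "noise p s b i j = sym_matrix (2 * s) b $$ (i, j) - band_prob p s i j"

lemma finite_upper_pairs [simp]: "finite (upper_pairs n)"
  by (rule finite_subset[of _ "{..<n} \<times> {..<n}"]) (auto simp: upper_pairs_def)

lemma sum_square_upper_pairs:
  fixes g :: "nat \<Rightarrow> nat \<Rightarrow> real"
  shows "(\<Sum>i<n. \<Sum>j<n. g i j) = (\<Sum>(i, j)\<in>upper_pairs n. g i j + g j i) + (\<Sum>i<n. g i i)"
proof -
  let ?L = "(\<lambda>(i, j). (j, i)) ` upper_pairs n" and ?D = "(\<lambda>i. (i, i)) ` {..<n}"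
  have "{..<n} \<times> {..<n} = (upper_pairs n \<union> ?L) \<union> ?D"
  proof (intro equalityI subsetI)
    fix q assume "q \<in> {..<n} \<times> {..<n}"
    then obtain i j where "q = (i, j)" "i < n" "j < n" by auto
    thus "q \<in> (upper_pairs n \<union> ?L) \<union> ?D"
      by (cases i j rule: linorder_cases) (auto simp: upper_pairs_def image_iff)
  qed (auto simp: upper_pairs_def)
  hence "(\<Sum>i<n. \<Sum>j<n. g i j) = (\<Sum>(i, j)\<in>(upper_pairs n \<union> ?L) \<union> ?D. g i j)"
    by (simp add: sum.cartesian_product)
  also have "\<dots> = (\<Sum>(i, j)\<in>upper_pairs n \<union> ?L. g i j) + (\<Sum>(i, j)\<in>?D. g i j)"
    by (intro sum.union_disjoint finite_UnI finite_imageI finite_upper_pairs)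
      (auto simp: upper_pairs_def)
  also have "(\<Sum>(i, j)\<in>upper_pairs n \<union> ?L. g i j)
      = (\<Sum>(i, j)\<in>upper_pairs n. g i j) + (\<Sum>(i, j)\<in>?L. g i j)"
    by (intro sum.union_disjoint finite_imageI finite_upper_pairs) (auto simp: upper_pairs_def)
  also have "(\<Sum>(i, j)\<in>?L. g i j) = (\<Sum>(i, j)\<in>upper_pairs n. g j i)"
    by (subst sum.reindex) (auto simp: inj_on_def case_prod_unfold)
  also have "(\<Sum>(i, j)\<in>?D. g i j) = (\<Sum>i<n. g i i)"
    by (subst sum.reindex) (auto simp: inj_on_def)
  finally show ?thesis by (simp add: sum.distrib case_prod_unfold)
qed

lemma band_prob_diag: "band_prob p s i i = 0"
  by (simp add: band_prob_def)

lemma band_prob_commute: "band_prob p s i j = band_prob p s j i"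
  by (simp add: band_prob_def abs_minus_commute)

text \<open>Only the entries above the diagonal are independent. Collecting both occurrences of each
  of them gives a sum of independent terms minus its mean, as Hoeffding's inequality
  requires.\<close>

lemma bilin_noise_upper:
  "bilin (2 * s) (noise p s b) x y =
    (\<Sum>(i, j)\<in>upper_pairs (2 * s). (x i * y j + x j * y i) * of_bool (b (i, j)))
    - (\<Sum>(i, j)\<in>upper_pairs (2 * s). (x i * y j + x j * y i) * band_prob p s i j)"
proof -
  have "bilin (2 * s) (noise p s b) x y =
      (\<Sum>(i, j)\<in>upper_pairs (2 * s). x i * noise p s b i j * y j + x j * noise p s b j i * y i)
      + (\<Sum>i<2 * s. x i * noise p s b i i * y i)"
    unfolding bilin_def by (rule sum_square_upper_pairs)
  also have "(\<Sum>i<2 * s. x i * noise p s b i i * y i) = 0"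
    by (intro sum.neutral) (auto simp: noise_def sym_matrix_def band_prob_diag)
  also have "(\<Sum>(i, j)\<in>upper_pairs (2 * s). x i * noise p s b i j * y j + x j * noise p s b j i * y i)
      = (\<Sum>(i, j)\<in>upper_pairs (2 * s). (x i * y j + x j * y i) * of_bool (b (i, j))
          - (x i * y j + x j * y i) * band_prob p s i j)"
    by (intro sum.cong)
      (auto simp: noise_def sym_matrix_def upper_pairs_def band_prob_commute[of p s] algebra_simps)
  finally show ?thesis by (simp add: sum_subtractf case_prod_unfold)
qed

text \<open>From \<open>(a + b)^2 \<le> 2 * a^2 + 2 * b^2\<close>: the two terms range over opposite
  triangles of the square, which are disjoint. This controls the total squared width in Hoeffding's
  inequality.\<close>

lemma sum_upper_pairs_sq_le:
  "(\<Sum>(i, j)\<in>upper_pairs n. (x i * y j + x j * y i)\<^sup>2) \<le> 2 * sqnorm n x * sqnorm n y"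
proof -
  have "(\<Sum>(i, j)\<in>upper_pairs n. (x i * y j + x j * y i)\<^sup>2)
      \<le> (\<Sum>(i, j)\<in>upper_pairs n. 2 * (x i * y j)\<^sup>2 + 2 * (x j * y i)\<^sup>2)"
  proof (rule sum_mono)
    fix q
    show "(case q of (i, j) \<Rightarrow> (x i * y j + x j * y i)\<^sup>2)
        \<le> (case q of (i, j) \<Rightarrow> 2 * (x i * y j)\<^sup>2 + 2 * (x j * y i)\<^sup>2)"
      using sum_squares_bound[of "x (fst q) * y (snd q)" "x (snd q) * y (fst q)"]
      by (simp only: case_prod_unfold power2_sum)
  qed
  also have "\<dots> \<le> (\<Sum>i<n. \<Sum>j<n. 2 * (x i * y j)\<^sup>2)"
    unfolding sum_square_upper_pairs by (simp add: sum_nonneg)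
  also have "\<dots> = 2 * sqnorm n x * sqnorm n y"
    by (simp add: sqnorm_def sum_product power_mult_distrib sum_distrib_left mult_ac)
  finally show ?thesis .
qed

lemma prob_bilin_noise_ge:
  assumes p: "0 \<le> p" "p \<le> 1" and x: "sqnorm (2 * s) x \<le> 1" and y: "sqnorm (2 * s) y \<le> 1" and t: "t > 0"
  shows "measure_pmf.prob (entries_pmf p s) {b. \<bar>bilin (2 * s) (noise p s b) x y\<bar> \<ge> t} \<le> 2 * exp (- t\<^sup>2)"
proof -
  let ?I = "upper_pairs (2 * s)" and ?M = "entries_pmf p s"
  define c where "c q = x (fst q) * y (snd q) + x (snd q) * y (fst q)" for q
  define X where "X q b = c q * of_bool (b q)" for q and b :: "nat \<times> nat \<Rightarrow> bool"
  define V where "V = (\<Sum>q\<in>?I. (c q)\<^sup>2)"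
  have V2: "V \<le> 2"
  proof -
    have "V \<le> 2 * sqnorm (2 * s) x * sqnorm (2 * s) y"
      unfolding V_def c_def using sum_upper_pairs_sq_le[of x y "2 * s"] by (simp add: case_prod_unfold)
    also have "\<dots> \<le> 2 * 1 * 1" using x y by (intro mult_mono) auto
    finally show ?thesis by simp
  qed
  have prob01: "band_prob p s i j \<in> {0..1}" for i j
    using p by (simp add: band_prob_def)
  have comp: "map_pmf (\<lambda>b. b q) ?M = bernoulli_pmf (band_prob p s (fst q) (snd q))" if "q \<in> ?I" for q
    unfolding entries_pmf_def by (subst Pi_pmf_component) (use that in \<open>auto simp: case_prod_unfold\<close>)
  have exp_X: "measure_pmf.expectation ?M (X q) = c q * band_prob p s (fst q) (snd q)" if "q \<in> ?I" for q
  proof -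
    have "measure_pmf.expectation ?M (X q)
        = measure_pmf.expectation (map_pmf (\<lambda>b. b q) ?M) (\<lambda>a. c q * of_bool a)"
      by (simp add: X_def[abs_def])
    also have "\<dots> = c q * band_prob p s (fst q) (snd q)"
      unfolding comp[OF that] using prob01[of "fst q" "snd q"] by (subst integral_bernoulli_pmf) auto
    finally show ?thesis .
  qed
  \<comment> \<open>Each summand takes only the values 0 and \<open>c q\<close>; the minimum and
    maximum account for the unknown sign of \<open>c q\<close>, and the interval has width
    \<open>\<bar>c q\<bar>\<close> either way.\<close>
  interpret Hoeffding_ineq "measure_pmf ?M" ?I X "\<lambda>q. min 0 (c q)" "\<lambda>q. max 0 (c q)"
    "\<Sum>q\<in>?I. measure_pmf.expectation ?M (X q)"
  proof unfold_locales
    have "prob_space.indep_vars (measure_pmf ?M) (\<lambda>_. count_space UNIV) (\<lambda>q b. b q) ?I"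
      unfolding entries_pmf_def by (rule indep_vars_Pi_pmf) simp
    thus "prob_space.indep_vars (measure_pmf ?M) (\<lambda>_. borel) X ?I"
      unfolding X_def by (rule prob_space.indep_vars_compose2[OF measure_pmf.prob_space_axioms]) auto
  qed (auto simp: X_def AE_measure_pmf_iff)
  have bilin_eq: "bilin (2 * s) (noise p s b) x y
      = (\<Sum>q\<in>?I. X q b) - (\<Sum>q\<in>?I. measure_pmf.expectation ?M (X q))" for b
    unfolding bilin_noise_upper using exp_X by (simp add: X_def c_def case_prod_unfold)
  have width: "(\<Sum>q\<in>?I. (max 0 (c q) - min 0 (c q))\<^sup>2) = V"
    unfolding V_def by (intro sum.cong) (auto simp: max_def min_def)
  show ?thesis
  \<comment> \<open>Hoeffding's inequality divides by the total squared width. If that is zero, all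
    coefficients vanish and so does the form.\<close>
  proof (cases "V > 0")
    case True
    have "measure_pmf.prob ?M {b. \<bar>bilin (2 * s) (noise p s b) x y\<bar> \<ge> t} \<le> 2 * exp (- 2 * t\<^sup>2 / V)"
      using Hoeffding_ineq_abs_ge[of t] True t unfolding width bilin_eq by simp
    also have "t\<^sup>2 * V \<le> t\<^sup>2 * 2" using V2 by (intro mult_left_mono) auto
    hence "- 2 * t\<^sup>2 / V \<le> - t\<^sup>2"
      using True by (simp add: field_simps)
    hence "2 * exp (- 2 * t\<^sup>2 / V) \<le> 2 * exp (- t\<^sup>2)" by simp
    finally show ?thesis .
  next
    case False
    have "(\<Sum>q\<in>?I. (c q)\<^sup>2) = 0"
      using False sum_nonneg[of ?I "\<lambda>q. (c q)\<^sup>2"] unfolding V_def by force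
    hence "c q = 0" if "q \<in> ?I" for q
      using that by (subst (asm) sum_nonneg_eq_0_iff) auto
    hence "bilin (2 * s) (noise p s b) x y = 0" for b
      unfolding bilin_eq by (simp add: exp_X X_def)
    thus ?thesis using t by simp
  qed
qed

text \<open>A union bound over pairs of net points at level \<open>t = sqrt (40 * n)\<close>; the
  further factor 2 is the price of passing from the net to all vectors.\<close>

lemma prob_noise_bounded:
  assumes p: "0 \<le> p" "p \<le> 1" and s: "s \<ge> 1"
  defines "n \<equiv> 2 * s"
  shows "measure_pmf.prob (entries_pmf p s)
      {b. \<forall>x y. \<bar>bilin n (noise p s b) x y\<bar> \<le> 2 * sqrt (40 * real n) * sqrt (sqnorm n x) * sqrt (sqnorm n y)}
    \<ge> 1 - 1 / real n ^ 3"
proof -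
  let ?M = "entries_pmf p s"
  define t where "t = sqrt (40 * real n)"
  have n: "n > 0" using s by (simp add: n_def)
  have t: "t > 0" using n by (simp add: t_def)
  define F where "F = (\<lambda>(z, w). {b. \<bar>bilin n (noise p s b) (lattice_vec n z) (lattice_vec n w)\<bar> \<ge> t})"
  let ?N = "lattice_ball n \<times> lattice_ball n"
  let ?G = "{b. \<forall>x y. \<bar>bilin n (noise p s b) x y\<bar> \<le> 2 * t * sqrt (sqnorm n x) * sqrt (sqnorm n y)}"
  have "measure_pmf.prob ?M (- ?G) \<le> measure_pmf.prob ?M (\<Union>q\<in>?N. F q)"
  proof (rule measure_pmf.finite_measure_mono)
    show "- ?G \<subseteq> (\<Union>q\<in>?N. F q)"
    proof
      fix b assume "b \<in> - ?G"
      hence "\<not> (\<forall>z\<in>lattice_ball n. \<forall>w\<in>lattice_ball n.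
          \<bar>bilin n (noise p s b) (lattice_vec n z) (lattice_vec n w)\<bar> \<le> t)"
        using bilin_le_of_lattice[of n "noise p s b" t] by blast
      thus "b \<in> (\<Union>q\<in>?N. F q)" unfolding F_def by force
    qed
  qed auto
  also have "\<dots> \<le> (\<Sum>q\<in>?N. measure_pmf.prob ?M (F q))"
    by (intro measure_pmf.finite_measure_subadditive_finite) (auto simp: finite_lattice_ball)
  also have "\<dots> \<le> (\<Sum>q\<in>?N. 2 * exp (- t\<^sup>2))"
    unfolding F_def n_def case_prod_unfold
    by (intro sum_mono prob_bilin_noise_ge p t sqnorm_lattice_vec) (use n in \<open>auto simp: n_def\<close>)
  also have "\<dots> = (real (card (lattice_ball n)))\<^sup>2 * (2 * exp (- (40 * real n)))"
    by (simp add: card_cartesian_product t_def power2_eq_square)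
  also have "\<dots> \<le> (2 ^ (18 * n))\<^sup>2 * (2 * exp (- (40 * real n)))"
    by (intro mult_right_mono power_mono card_lattice_ball) auto
  also have "\<dots> \<le> 1 / real n ^ 3" using n by (intro exp_net_bound) simp
  finally have "measure_pmf.prob ?M (- ?G) \<le> 1 / real n ^ 3" .
  moreover have "measure_pmf.prob ?M (- ?G) = 1 - measure_pmf.prob ?M ?G"
    using measure_pmf.prob_compl[of ?G ?M] by (simp add: Compl_eq_Diff_UNIV)
  ultimately show ?thesis unfolding t_def by simp
qed

section \<open>The mean matrix\<close>

text \<open>Jordan's inequality: the concave sine lies above its chord between 0 and
  \<open>pi / 2\<close>.\<close>

lemma two_div_pi_le_sin:
  fixes x :: real
  assumes "0 \<le> x" "x \<le> pi / 2"
  shows "2 * x / pi \<le> sin x"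
proof -
  have "concave_on {0..pi / 2} (sin :: real \<Rightarrow> real)"
  proof (rule f''_le0_imp_concave)
    show "- sin t \<le> 0" if "t \<in> {0..pi / 2}" for t :: real
      using that sin_ge_zero[of t] by auto
  qed (auto intro!: derivative_eq_intros)
  hence "\<forall>u\<ge>0. \<forall>v\<ge>0. u + v = 1 \<longrightarrow>
      u * sin 0 + v * sin (pi / 2) \<le> sin (u *\<^sub>R 0 + v *\<^sub>R (pi / 2 :: real))"
    unfolding concave_on_iff
    by (elim conjE, drule_tac bspec[of _ _ 0], simp, drule_tac bspec[of _ _ "pi / 2"]) simp_all
  from this[rule_format, of "1 - 2 * x / pi" "2 * x / pi"] show ?thesis
    using assms by (simp add: field_simps)
qed

text \<open>Otherwise \<open>8 / 15 \<le> pi / 6\<close>, hence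
  \<open>sin (8 / 15) \<le> 1 / 2\<close>, whereas the Taylor bound puts this sine above
  0.508.\<close>

lemma pi_less_16_div_5: "pi < 16 / 5"
proof (rule ccontr)
  assume "\<not> ?thesis"
  hence "sin (8 / 15) \<le> sin (pi / 6)"
    by (intro sin_monotone_2pi_le) (use pi_gt_zero in \<open>auto simp: field_simps\<close>)
  moreover have "\<bar>sin (8 / 15) - 8 / 15\<bar> \<le> (8 / 15 :: real) ^ 3 / 6"
    using Maclaurin_sin_bound[of "8 / 15" 3]
    by (simp add: numeral_eq_Suc sin_coeff_def fact_numeral)
  ultimately show False by (simp add: sin_30 power3_eq_cube)
qed

text \<open>With \<theta> = \<open>pi / (4 * s + 2)\<close>, this samples the cosine at the odd
  multiples of \<theta> below \<open>pi\<close>, leaving out the middle one,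
  \<open>(2 * s + 1)\<close> times \<theta>, which is \<open>pi / 2\<close>. The reflection at
  \<open>pi\<close> turns the negated second half of \<open>u_vec\<close> into the same
  formula.\<close>

definition u_fun :: "nat \<Rightarrow> nat \<Rightarrow> real" where
  "u_fun s i = cos (real (if i < s then 2 * i + 1 else 2 * i + 3) * (pi / (4 * real s + 2)))"

lemma u_vec_eq:
  assumes "i < 2 * s"
  shows "u_vec s $ i = u_fun s i"
proof (cases "i < s")
  case True
  thus ?thesis by (simp add: u_vec_def u_fun_def Let_def add.commute)
next
  case False
  have "- cos ((2 * real (2 * s - (i + 1) + 1) - 1) * pi / (4 * real s + 2))
      = cos (pi - (2 * real (2 * s - (i + 1) + 1) - 1) * pi / (4 * real s + 2))"
    by simp
  also have "pi - (2 * real (2 * s - (i + 1) + 1) - 1) * pi / (4 * real s + 2)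
      = real (2 * i + 3) * (pi / (4 * real s + 2))"
    using assms by (simp add: of_nat_diff field_simps)
  finally show ?thesis using False assms by (simp add: u_vec_def u_fun_def Let_def)
qed

text \<open>A row of the mean matrix sums over a window of indices without its centre. The truncated
  subtraction \<open>i + 1 - s\<close> and the minimum cut the window off at the two ends of the
  index range.\<close>

lemma sum_band_prob:
  assumes "i < 2 * s"
  shows "(\<Sum>j<2 * s. band_prob p s i j * g j)
    = p * ((\<Sum>j = i + 1 - s..<min (i + s) (2 * s). g j) - g i)"
proof -
  have "(\<Sum>j<2 * s. band_prob p s i j * g j)
      = (\<Sum>j<2 * s. if j \<in> {i + 1 - s..<min (i + s) (2 * s)} then (if j = i then 0 else p * g j) else 0)"
    using assms by (intro sum.cong) (auto simp: band_prob_def)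
  also have "\<dots> = (\<Sum>j = i + 1 - s..<min (i + s) (2 * s). if j = i then 0 else p * g j)"
    by (subst sum.inter_restrict[symmetric]) (auto intro!: sum.cong)
  also have "\<dots> = (\<Sum>j = i + 1 - s..<min (i + s) (2 * s). p * g j - (if j = i then p * g i else 0))"
    by (intro sum.cong) auto
  also have "\<dots> = p * (\<Sum>j = i + 1 - s..<min (i + s) (2 * s). g j) - p * g i"
    using assms by (simp add: sum_subtractf sum_distrib_left)
  finally show ?thesis by (simp add: algebra_simps)
qed

text \<open>The product formula for \<open>2 * sin \<theta> * cos\<close> makes window sums
  telescope. One end of the window always meets a zero of the sine, and the other end is a quarter
  turn away from the angle of index \<open>i\<close>. The summand -1 of the eigenvalue comes from
  the excluded diagonal.\<close>

lemma u_fun_eigenvector: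
  assumes i: "i < 2 * s"
  defines "\<theta> \<equiv> pi / (4 * real s + 2)"
  shows "(\<Sum>j<2 * s. band_prob p s i j * u_fun s j) = p * (1 / (2 * sin \<theta>) - 1) * u_fun s i"
proof -
  have s: "s \<ge> 1" using i by simp
  have \<theta>: "\<theta> > 0" "\<theta> < pi" "(4 * real s + 2) * \<theta> = pi"
    using s by (auto simp: \<theta>_def field_simps intro: add_pos_nonneg)
  hence sin: "sin \<theta> > 0" by (intro sin_gt_zero) auto
  have prod: "2 * sin \<theta> * cos (x * \<theta>) = sin ((x + 1) * \<theta>) - sin ((x - 1) * \<theta>)" for x
    by (simp add: algebra_simps sin_add sin_diff)
  \<comment> \<open>The two angles are mirror images about the omitted angle \<open>pi / 2\<close>,
    so the telescoping passes over the gap undisturbed.\<close>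
  have refl: "sin ((2 * real s + 2) * \<theta>) = sin (2 * real s * \<theta>)"
  proof -
    have "(2 * real s + 2) * \<theta> = pi - 2 * real s * \<theta>" using \<theta>(3) by (simp add: algebra_simps)
    thus ?thesis by simp
  qed
  have u: "u_fun s j = cos (real (if j < s then 2 * j + 1 else 2 * j + 3) * \<theta>)" for j
    by (simp add: u_fun_def \<theta>_def)
  \<comment> \<open>A discrete antiderivative of \<open>2 * sin \<theta> * u_fun s j\<close>.\<close>
  define G where "G j = sin (real (if j \<le> s then 2 * j else 2 * j + 2) * \<theta>)" for j :: nat
  have G: "2 * sin \<theta> * u_fun s j = G (Suc j) - G j" for j
  proof (cases j s rule: linorder_cases)
    case less
    thus ?thesis using prod[of "2 * real j + 1"]
      by (simp add: u G_def add_ac)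
  next
    case equal
    thus ?thesis using prod[of "2 * real j + 3"] refl
      by (simp add: u G_def add_ac)
  next
    case greater
    thus ?thesis using prod[of "2 * real j + 3"]
      by (simp add: u G_def add_ac)
  qed
  have sumG: "2 * sin \<theta> * (\<Sum>j = a..<b. u_fun s j) = G b - G a" if "a \<le> b" for a b
    unfolding sum_distrib_left G using that by (simp add: sum_Suc_diff')
  have "2 * sin \<theta> * (\<Sum>j = i + 1 - s..<min (i + s) (2 * s). u_fun s j) = u_fun s i"
  proof (cases "i < s")
    case True
    have "2 * sin \<theta> * (\<Sum>j = i + 1 - s..<min (i + s) (2 * s). u_fun s j) = G (i + s) - G 0"
      using True by (subst sumG) (auto simp: min_def)
    also have "\<dots> = sin ((2 * real i + 2 * real s + 2) * \<theta>)"
      using refl by (cases "i = 0") (auto simp: G_def algebra_simps)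
    also have "(2 * real i + 2 * real s + 2) * \<theta> = (2 * real i + 1) * \<theta> + pi / 2"
      using \<theta>(3) by (simp add: algebra_simps)
    also have "sin \<dots> = u_fun s i"
      using True by (simp add: sin_add u add.commute)
    finally show ?thesis .
  next
    case False
    have "2 * sin \<theta> * (\<Sum>j = i + 1 - s..<min (i + s) (2 * s). u_fun s j) = G (2 * s) - G (i + 1 - s)"
      using False i by (subst sumG) (auto simp: min_def mult_2)
    also have "\<dots> = - sin ((2 * real i - 2 * real s + 2) * \<theta>)"
    proof -
      have "G (2 * s) = sin ((4 * real s + 2) * \<theta>)"
        using s by (simp add: G_def algebra_simps)
      moreover have "G (i + 1 - s) = sin ((2 * real i - 2 * real s + 2) * \<theta>)"
      proof -
        have "i + 1 - s \<le> s" using False i by simp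
        hence "G (i + 1 - s) = sin (2 * real (i + 1 - s) * \<theta>)" by (simp only: G_def if_True) simp
        also have "real (i + 1 - s) = real i + 1 - real s" using False by (simp add: of_nat_diff)
        finally show ?thesis by (simp add: algebra_simps)
      qed
      ultimately show ?thesis unfolding \<theta>(3) by simp
    qed
    also have "(2 * real i - 2 * real s + 2) * \<theta> = (2 * real i + 3) * \<theta> - pi / 2"
      using \<theta>(3) by (simp add: algebra_simps)
    also have "- sin \<dots> = u_fun s i"
      using False by (simp add: sin_diff u add.commute)
    finally show ?thesis .
  qed
  hence "(\<Sum>j = i + 1 - s..<min (i + s) (2 * s). u_fun s j) = 1 / (2 * sin \<theta>) * u_fun s i"
    using sin by (simp add: field_simps)
  thus ?thesis by (simp only: sum_band_prob[OF i]) (simp add: algebra_simps)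
qed

section \<open>Sum of the entries and squared Frobenius norm of the mean matrix\<close>

lemma sum_band_prob_row:
  assumes "i < 2 * s"
  shows "(\<Sum>j<2 * s. band_prob p s i j) = p * (real (min (i + s) (2 * s) - (i + 1 - s)) - 1)"
  using sum_band_prob[OF assms, of p "\<lambda>_. 1"] by simp

text \<open>Rows \<open>i\<close> and \<open>i + s\<close> are paired: their windows have
  \<open>i + s\<close> and \<open>2 * s - i - 1\<close> elements, together \<open>3 * s - 1\<close>
  for every \<open>i < s\<close>.\<close>

lemma sum_band_prob_all:
  assumes "s \<ge> 1"
  shows "(\<Sum>i<2 * s. \<Sum>j<2 * s. band_prob p s i j) = p * (3 * real s * (real s - 1))"
proof -
  define h where "h i = real (min (i + s) (2 * s) - (i + 1 - s))" for i
  have "(\<Sum>i<2 * s. h i) = (\<Sum>i<s. h i) + (\<Sum>i<s. h (i + s))"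
  proof -
    have "(\<Sum>i<s + s. h i) = (\<Sum>i<s. h i) + (\<Sum>i<s. h (i + s))"
      using sum.nat_group[of h s 2]
      by (simp add: sum.atLeastLessThan_concat[of 0 s "s + s" h, symmetric] atLeast0LessThan[symmetric]
          sum.shift_bounds_nat_ivl[of h 0 s s, simplified])
    thus ?thesis by (simp add: mult_2)
  qed
  also have "\<dots> = (\<Sum>i<s. h i + h (i + s))" by (simp add: sum.distrib)
  also have "\<dots> = (\<Sum>i<s. 3 * real s - 1)"
    by (intro sum.cong) (auto simp: h_def min_def of_nat_diff)
  finally have h: "(\<Sum>i<2 * s. h i) = real s * (3 * real s - 1)" by simp
  have "(\<Sum>i<2 * s. \<Sum>j<2 * s. band_prob p s i j) = (\<Sum>i<2 * s. p * (h i - 1))"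
    by (intro sum.cong) (auto simp: sum_band_prob_row h_def)
  also have "\<dots> = p * ((\<Sum>i<2 * s. h i) - 2 * real s)"
    by (simp add: sum_distrib_left[symmetric] sum_subtractf)
  finally show ?thesis unfolding h by (simp add: algebra_simps)
qed

lemma sum_band_prob_sq_all:
  assumes "s \<ge> 1"
  shows "(\<Sum>i<2 * s. \<Sum>j<2 * s. (band_prob p s i j)\<^sup>2) = p\<^sup>2 * (3 * real s * (real s - 1))"
proof -
  have "(\<Sum>i<2 * s. \<Sum>j<2 * s. (band_prob p s i j)\<^sup>2) = (\<Sum>i<2 * s. \<Sum>j<2 * s. p * band_prob p s i j)"
    by (intro sum.cong) (auto simp: band_prob_def power2_eq_square)
  also have "\<dots> = p * (p * (3 * real s * (real s - 1)))"
    unfolding sum_distrib_left[symmetric] sum_band_prob_all[OF assms] ..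
  finally show ?thesis by (simp add: power2_eq_square)
qed

section \<open>Eigenbases and perturbation\<close>

definition mat_apply :: "nat \<Rightarrow> (nat \<Rightarrow> nat \<Rightarrow> real) \<Rightarrow> (nat \<Rightarrow> real) \<Rightarrow> nat \<Rightarrow> real" where
  "mat_apply n A x i = (\<Sum>j<n. A i j * x j)"

definition dot :: "nat \<Rightarrow> (nat \<Rightarrow> real) \<Rightarrow> (nat \<Rightarrow> real) \<Rightarrow> real" where
  "dot n x y = (\<Sum>i<n. x i * y i)"

lemma bilin_eq_dot: "bilin n A x y = dot n x (mat_apply n A y)"
  by (simp add: bilin_def dot_def mat_apply_def sum_distrib_left mult_ac)

lemma sqnorm_eq_dot: "sqnorm n x = dot n x x"
  by (simp add: sqnorm_def dot_def power2_eq_square)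

text \<open>Testing the form against the image of \<open>x\<close> itself and cancelling one factor
  turns the bound on the form into a bound on the operator norm.\<close>

lemma sqnorm_mat_apply_le:
  assumes "\<And>x y. \<bar>bilin n E x y\<bar> \<le> e * sqrt (sqnorm n x) * sqrt (sqnorm n y)"
  shows "sqrt (sqnorm n (mat_apply n E x)) \<le> e * sqrt (sqnorm n x)"
proof -
  let ?y = "mat_apply n E x"
  have "sqnorm n ?y \<le> e * sqrt (sqnorm n ?y) * sqrt (sqnorm n x)"
    using assms[of ?y x] unfolding bilin_eq_dot sqnorm_eq_dot[symmetric] by linarith
  hence *: "sqrt (sqnorm n ?y) * sqrt (sqnorm n ?y) \<le> sqrt (sqnorm n ?y) * (e * sqrt (sqnorm n x))"
    by (simp add: mult_ac)
  show ?thesis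
  proof (cases "sqnorm n ?y = 0")
    case False
    hence "sqrt (sqnorm n ?y) > 0" using sqnorm_nonneg[of n ?y] by (simp add: order_less_le)
    thus ?thesis using * by (rule mult_left_le_imp_le[rotated])
  next
    \<comment> \<open>For a zero image the right-hand side must be shown nonnegative; the sign of
      \<open>e\<close> is read off from the bound at the pair \<open>x\<close>,
      \<open>x\<close>.\<close>
    case True
    show ?thesis
    proof (cases "sqnorm n x = 0")
      case False
      have "0 \<le> e * sqrt (sqnorm n x) * sqrt (sqnorm n x)" using assms[of x x] by linarith
      hence "0 \<le> e * sqnorm n x" by (simp add: mult.assoc)
      hence "0 \<le> e" using False sqnorm_nonneg[of n x] by (simp add: zero_le_mult_iff order_less_le)
      thus ?thesis using True by simp
    qed (use True in simp)
  qed
qed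

text \<open>\<open>orthonormal\<close> is the orthogonality of the columns of the diagonalizing
  matrix and \<open>complete\<close> that of its rows; Parseval's identity rests on the
  latter.\<close>

locale eigenbasis =
  fixes n :: nat and A :: "nat \<Rightarrow> nat \<Rightarrow> real" and f :: "nat \<Rightarrow> nat \<Rightarrow> real" and l :: "nat \<Rightarrow> real"
  assumes sym: "\<And>i j. i < n \<Longrightarrow> j < n \<Longrightarrow> A i j = A j i"
    and orthonormal: "\<And>a b. a < n \<Longrightarrow> b < n \<Longrightarrow> dot n (f a) (f b) = (if a = b then 1 else 0)"
    and complete: "\<And>i j. i < n \<Longrightarrow> j < n \<Longrightarrow> (\<Sum>a<n. f a i * f a j) = (if i = j then 1 else 0)"
    and eigen: "\<And>a i. a < n \<Longrightarrow> i < n \<Longrightarrow> mat_apply n A (f a) i = l a * f a i"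
begin

lemma parseval_dot: "(\<Sum>a<n. dot n x (f a) * dot n y (f a)) = dot n x y"
proof -
  have "(\<Sum>a<n. dot n x (f a) * dot n y (f a)) = (\<Sum>a<n. \<Sum>i<n. \<Sum>j<n. x i * y j * (f a i * f a j))"
    by (simp add: dot_def sum_product mult_ac)
  also have "\<dots> = (\<Sum>i<n. \<Sum>j<n. x i * y j * (\<Sum>a<n. f a i * f a j))"
    unfolding sum_distrib_left
    by (rule trans[OF sum.swap]) (intro sum.cong refl sum.swap)
  also have "\<dots> = (\<Sum>i<n. \<Sum>j<n. if i = j then x i * y j else 0)"
    by (intro sum.cong) (auto simp: complete)
  also have "\<dots> = dot n x y"
    by (simp add: dot_def)
  finally show ?thesis .
qed

lemma parseval: "(\<Sum>a<n. (dot n x (f a))\<^sup>2) = sqnorm n x"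
  using parseval_dot[of x x] by (simp add: sqnorm_eq_dot power2_eq_square)

text \<open>Parseval's identity for each row: the Frobenius norm may be computed in any orthonormal
  basis. Here \<open>M\<close> is arbitrary; it will be the mean matrix, while the basis belongs to
  \<open>A\<close>.\<close>

lemma sum_sqnorm_mat_apply:
  "(\<Sum>a<n. sqnorm n (mat_apply n M (f a))) = (\<Sum>i<n. \<Sum>j<n. (M i j)\<^sup>2)"
proof -
  have "(\<Sum>a<n. sqnorm n (mat_apply n M (f a))) = (\<Sum>i<n. \<Sum>a<n. (dot n (M i) (f a))\<^sup>2)"
    unfolding sqnorm_def mat_apply_def dot_def by (rule sum.swap)
  also have "\<dots> = (\<Sum>i<n. \<Sum>j<n. (M i j)\<^sup>2)"
    unfolding parseval by (simp add: sqnorm_def)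
  finally show ?thesis .
qed

lemma dot_mat_apply:
  assumes "a < n"
  shows "dot n (mat_apply n A x) (f a) = l a * dot n x (f a)"
proof -
  have "dot n (mat_apply n A x) (f a) = (\<Sum>i<n. \<Sum>j<n. A i j * x j * f a i)"
    by (simp add: dot_def mat_apply_def sum_distrib_right)
  also have "\<dots> = (\<Sum>j<n. x j * mat_apply n A (f a) j)"
    by (subst sum.swap) (auto simp: mat_apply_def sum_distrib_left sym mult_ac intro!: sum.cong)
  also have "\<dots> = l a * dot n x (f a)"
    by (simp add: dot_def eigen[OF assms] sum_distrib_left mult_ac)
  finally show ?thesis .
qed

text \<open>A small residual forces \<open>x\<close> to have little weight on eigenvectors whose
  eigenvalues are far from \<open>c\<close>. With \<open>c = 0\<close> this is the norm of the
  image.\<close>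

lemma sqnorm_residual:
  "sqnorm n (\<lambda>i. mat_apply n A x i - c * x i) = (\<Sum>a<n. (l a - c)\<^sup>2 * (dot n x (f a))\<^sup>2)"
proof -
  have "dot n (\<lambda>i. mat_apply n A x i - c * x i) (f a) = (l a - c) * dot n x (f a)" if "a < n" for a
  proof -
    have "dot n (\<lambda>i. mat_apply n A x i - c * x i) (f a) = dot n (mat_apply n A x) (f a) - c * dot n x (f a)"
      unfolding dot_def sum_distrib_left sum_subtractf[symmetric]
      by (intro sum.cong) (auto simp: algebra_simps)
    thus ?thesis by (simp add: dot_mat_apply[OF that] algebra_simps)
  qed
  thus ?thesis by (simp add: parseval[symmetric] power_mult_distrib)
qed

lemma bilin_le_max_eigenvalue:
  assumes "\<And>a. a < n \<Longrightarrow> \<bar>l a\<bar> \<le> R" "n > 0"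
  shows "bilin n A x x \<le> R * sqnorm n x"
proof -
  have R: "R \<ge> 0" using assms(1)[OF assms(2)] by linarith
  have "sqnorm n (\<lambda>i. mat_apply n A x i - 0 * x i) \<le> (\<Sum>a<n. R\<^sup>2 * (dot n x (f a))\<^sup>2)"
    unfolding sqnorm_residual using assms(1)
    by (intro sum_mono mult_right_mono) (auto simp: abs_le_square_iff[symmetric] abs_of_nonneg[OF R])
  hence "sqnorm n (mat_apply n A x) \<le> R\<^sup>2 * sqnorm n x"
    by (simp add: sum_distrib_left[symmetric] parseval)
  hence "sqrt (sqnorm n (mat_apply n A x)) \<le> R * sqrt (sqnorm n x)"
    using R by (metis real_sqrt_abs real_sqrt_le_iff real_sqrt_mult abs_of_nonneg)
  hence "sqrt (sqnorm n x) * sqrt (sqnorm n (mat_apply n A x)) \<le> sqrt (sqnorm n x) * (R * sqrt (sqnorm n x))"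
    by (intro mult_left_mono) auto
  moreover have "bilin n A x x \<le> sqrt (sqnorm n x) * sqrt (sqnorm n (mat_apply n A x))"
    using sum_mult_le_sqrt_sqnorm[of x "mat_apply n A x" n] unfolding bilin_eq_dot dot_def by linarith
  ultimately show ?thesis by (simp add: mult_ac)
qed

end

lemma eigenbasis_of_char_poly:
  fixes A :: "real mat"
  assumes A: "A \<in> carrier_mat n n" and symA: "transpose_mat A = A"
    and cp: "char_poly A = (\<Prod>a\<leftarrow>ls. [:-a, 1:])"
  obtains f where "eigenbasis n (\<lambda>i j. A $$ (i, j)) f (\<lambda>a. ls ! a)" "length ls = n"
proof -
  obtain U where U: "U \<in> carrier_mat n n" "transpose_mat U * U = 1\<^sub>m n" "U * transpose_mat U = 1\<^sub>m n"
    "A * U = U * mat n n (\<lambda>(i, j). if i = j then ls ! i else 0)"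
    using real_symmetric_diagonalizable[OF A symA cp] by blast
  define f where "f a i = U $$ (i, a)" for a i
  have "eigenbasis n (\<lambda>i j. A $$ (i, j)) f (\<lambda>a. ls ! a)"
  proof
    fix i j assume "i < n" "j < n"
    thus "A $$ (i, j) = A $$ (j, i)" using A symA by (metis carrier_matD index_transpose_mat(1))
  next
    fix a b assume ab: "a < n" "b < n"
    have "dot n (f a) (f b) = (transpose_mat U * U) $$ (a, b)"
      using ab U(1) by (simp add: dot_def f_def scalar_prod_def atLeast0LessThan)
    thus "dot n (f a) (f b) = (if a = b then 1 else 0)" unfolding U(2) using ab by simp
  next
    fix i j assume ij: "i < n" "j < n"
    have "(\<Sum>a<n. f a i * f a j) = (U * transpose_mat U) $$ (i, j)"
      using ij U(1) by (simp add: f_def scalar_prod_def atLeast0LessThan)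
    thus "(\<Sum>a<n. f a i * f a j) = (if i = j then 1 else 0)" unfolding U(3) using ij by simp
  next
    fix a i assume ai: "a < n" "i < n"
    have "mat_apply n (\<lambda>i j. A $$ (i, j)) (f a) i = (A * U) $$ (i, a)"
      using ai U(1) A by (simp add: mat_apply_def f_def scalar_prod_def atLeast0LessThan)
    also have "\<dots> = (\<Sum>k<n. U $$ (i, k) * (if k = a then ls ! k else 0))"
      unfolding U(4) using ai U(1) by (simp add: scalar_prod_def atLeast0LessThan)
    also have "\<dots> = (\<Sum>k<n. if k = a then U $$ (i, k) * ls ! k else 0)"
      by (intro sum.cong) auto
    also have "\<dots> = ls ! a * f a i"
      using ai by (simp add: f_def)
    finally show "mat_apply n (\<lambda>i j. A $$ (i, j)) (f a) i = ls ! a * f a i" .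
  qed
  moreover have "length ls = n"
    using degree_monic_char_poly[OF A] degree_linear_factors[of uminus ls] unfolding cp by simp
  ultimately show ?thesis by (rule that)
qed

section \<open>Separation of the eigenvalues and closeness of the second eigenvector\<close>

lemma sqrt_sqnorm_triangle:
  "sqrt (sqnorm n (\<lambda>i. x i + y i)) \<le> sqrt (sqnorm n x) + sqrt (sqnorm n y)"
  using L2_set_triangle_ineq[of x y "{..<n}"] by (simp add: L2_set_def sqnorm_def)

lemma sqnorm_cong: "(\<And>i. i < n \<Longrightarrow> x i = y i) \<Longrightarrow> sqnorm n x = sqnorm n y"
  by (simp add: sqnorm_def)

context eigenbasis
begin

text \<open>The Rayleigh quotient at the all-ones vector: the mean matrix contributes
  \<open>3 * p * s * (s - 1)\<close> divided by \<open>2 * s\<close>, and the noise at most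
  \<open>e\<close>.\<close>

lemma eigenvalue_zero_lower_bound:
  assumes n: "n = 2 * s" "s \<ge> 1"
    and noise: "\<And>x y. \<bar>bilin n (\<lambda>i j. A i j - band_prob p s i j) x y\<bar> \<le> e * sqrt (sqnorm n x) * sqrt (sqnorm n y)"
    and sorted: "\<And>a b. a < b \<Longrightarrow> b < n \<Longrightarrow> \<bar>l b\<bar> \<le> \<bar>l a\<bar>"
  shows "3 / 2 * p * (real s - 1) - e \<le> \<bar>l 0\<bar>"
proof -
  let ?one = "\<lambda>_. 1 :: real"
  have one: "sqnorm n ?one = real n" by (simp add: sqnorm_def)
  have "bilin n A ?one ?one \<le> \<bar>l 0\<bar> * sqnorm n ?one"
    by (rule bilin_le_max_eigenvalue) (use sorted n in \<open>auto, metis gr0I order_refl\<close>)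
  moreover have "bilin n (\<lambda>i j. A i j - band_prob p s i j) ?one ?one
      = bilin n A ?one ?one - p * (3 * real s * (real s - 1))"
    using sum_band_prob_all[OF n(2), of p] by (simp add: bilin_def sum_subtractf n(1))
  moreover have "\<bar>bilin n (\<lambda>i j. A i j - band_prob p s i j) ?one ?one\<bar> \<le> e * real n"
    using noise[of ?one ?one] one by (simp add: mult.assoc)
  ultimately have "p * (3 * real s * (real s - 1)) - e * real n \<le> \<bar>l 0\<bar> * real n"
    unfolding one by linarith
  hence "(3 / 2 * p * (real s - 1) - e) * real n \<le> \<bar>l 0\<bar> * real n"
    by (simp add: n(1) algebra_simps)
  thus ?thesis using n by simp
qed

text \<open>On a unit eigenvector of \<open>A\<close> the mean matrix has an image of norm at least
  \<open>\<bar>l a\<bar> - e\<close>, and the squares of these norms over the whole basis add up to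
  its squared Frobenius norm. For a random 0/1 matrix with these means, the squared Frobenius norm
  is larger by the factor \<open>1 / p\<close> in expectation, so using it directly would lose too
  much.\<close>

lemma sum_eigenvalues_upper_bound:
  assumes n: "n = 2 * s" "s \<ge> 1"
    and noise: "\<And>x y. \<bar>bilin n (\<lambda>i j. A i j - band_prob p s i j) x y\<bar> \<le> e * sqrt (sqnorm n x) * sqrt (sqnorm n y)"
    and T: "T \<subseteq> {..<n}" "\<And>a. a \<in> T \<Longrightarrow> e \<le> \<bar>l a\<bar>"
  shows "(\<Sum>a\<in>T. (\<bar>l a\<bar> - e)\<^sup>2) \<le> p\<^sup>2 * (3 * real s * (real s - 1))"
proof -
  let ?M = "\<lambda>i j. band_prob p s i j" and ?E = "\<lambda>i j. A i j - band_prob p s i j"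
  have "(\<bar>l a\<bar> - e)\<^sup>2 \<le> sqnorm n (mat_apply n ?M (f a))" if "a \<in> T" for a
  proof -
    have a: "a < n" using that T by auto
    have f1: "sqnorm n (f a) = 1" using orthonormal[OF a a] by (simp add: sqnorm_eq_dot)
    have "\<bar>l a\<bar> = sqrt (sqnorm n (\<lambda>i. l a * f a i))"
      by (simp add: sqnorm_scale f1)
    also have "\<dots> = sqrt (sqnorm n (\<lambda>i. mat_apply n ?M (f a) i + mat_apply n ?E (f a) i))"
      by (intro arg_cong[of _ _ sqrt] sqnorm_cong)
        (simp add: eigen[OF a, symmetric] mat_apply_def flip: sum.distrib, simp add: algebra_simps)
    also have "\<dots> \<le> sqrt (sqnorm n (mat_apply n ?M (f a))) + sqrt (sqnorm n (mat_apply n ?E (f a)))"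
      by (rule sqrt_sqnorm_triangle)
    also have "sqrt (sqnorm n (mat_apply n ?E (f a))) \<le> e"
      using sqnorm_mat_apply_le[OF noise, of "f a"] f1 by simp
    finally have "\<bar>l a\<bar> - e \<le> sqrt (sqnorm n (mat_apply n ?M (f a)))" by simp
    hence "(\<bar>l a\<bar> - e)\<^sup>2 \<le> (sqrt (sqnorm n (mat_apply n ?M (f a))))\<^sup>2"
      using T(2)[OF that] by (intro power_mono) auto
    thus ?thesis by simp
  qed
  hence "(\<Sum>a\<in>T. (\<bar>l a\<bar> - e)\<^sup>2) \<le> (\<Sum>a\<in>T. sqnorm n (mat_apply n ?M (f a)))"
    by (intro sum_mono)
  also have "\<dots> \<le> (\<Sum>a<n. sqnorm n (mat_apply n ?M (f a)))"
    using T by (intro sum_mono2) auto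
  also have "\<dots> = (\<Sum>i<n. \<Sum>j<n. (band_prob p s i j)\<^sup>2)"
    by (rule sum_sqnorm_mat_apply)
  also have "\<dots> = p\<^sup>2 * (3 * real s * (real s - 1))"
    unfolding n(1) by (rule sum_band_prob_sq_all[OF n(2)])
  finally show ?thesis .
qed

text \<open>The squared Frobenius norm of the mean matrix is about \<open>3 * (p * s)\<^sup>2\<close>. The first eigenvalue
  takes up \<open>2.25 * (p * s)\<^sup>2\<close>, so that two more eigenvalues of modulus \<open>0.62 * p * s\<close> would
  exceed it, while the eigenvalue \<open>c\<close> of \<open>u\<close> is at least \<open>0.624 * p * s\<close>.\<close>

lemma eigenvalue_gap:
  assumes n: "n = 2 * s" "s \<ge> 3000" and p: "p > 0"
    and noise: "\<And>x y. \<bar>bilin n (\<lambda>i j. A i j - band_prob p s i j) x y\<bar> \<le> e * sqrt (sqnorm n x) * sqrt (sqnorm n y)"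
    and e: "0 \<le> e" "e \<le> p * real s / 4000"
    and sorted: "\<And>a b. a < b \<Longrightarrow> b < n \<Longrightarrow> \<bar>l b\<bar> \<le> \<bar>l a\<bar>"
    and lam: "624 / 1000 * (p * real s) \<le> c" "c \<le> p * real s"
    and a: "a < n" "a \<noteq> 1"
  shows "p * real s / 250 \<le> \<bar>l a - c\<bar>"
proof -
  define P where "P = p * real s"
  have P: "P > 0" using p n by (simp add: P_def)
  have pP: "p \<le> P / 3000" using p n by (simp add: P_def field_simps)
  have eP: "e \<le> P / 4000" using e by (simp add: P_def)
  have l0: "\<bar>l 0\<bar> \<ge> 1499 / 1000 * P"
  proof -
    have "3 / 2 * p * (real s - 1) - e \<le> \<bar>l 0\<bar>"
      using n by (intro eigenvalue_zero_lower_bound[OF n(1) _ noise sorted]) auto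
    also have "3 / 2 * p * (real s - 1) - e = 3 / 2 * P - 3 / 2 * p - e"
      by (simp add: P_def field_simps)
    finally show ?thesis using pP eP P by linarith
  qed
  have l2: "\<bar>l 2\<bar> < 62 / 100 * P"
  proof (rule ccontr)
    assume "\<not> ?thesis"
    hence l2: "\<bar>l 2\<bar> \<ge> 62 / 100 * P" by simp
    have l1: "\<bar>l 1\<bar> \<ge> 62 / 100 * P" using l2 sorted[of 1 2] n by linarith
    have "(\<Sum>a\<in>{0, 1, 2}. (\<bar>l a\<bar> - e)\<^sup>2) \<le> p\<^sup>2 * (3 * real s * (real s - 1))"
      using l0 l1 l2 eP P n by (intro sum_eigenvalues_upper_bound[OF n(1) _ noise]) auto
    also have "\<dots> \<le> 3 * P\<^sup>2"
      using p by (simp add: P_def power2_eq_square algebra_simps)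
    finally have "(\<bar>l 0\<bar> - e)\<^sup>2 + (\<bar>l 1\<bar> - e)\<^sup>2 + (\<bar>l 2\<bar> - e)\<^sup>2 \<le> 3 * P\<^sup>2"
      by simp
    moreover have "(1498 / 1000 * P)\<^sup>2 \<le> (\<bar>l 0\<bar> - e)\<^sup>2"
      using l0 eP P by (intro power_mono) auto
    moreover have "(619 / 1000 * P)\<^sup>2 \<le> (\<bar>l 1\<bar> - e)\<^sup>2" "(619 / 1000 * P)\<^sup>2 \<le> (\<bar>l 2\<bar> - e)\<^sup>2"
      using l1 l2 eP P by (intro power_mono; linarith)+
    \<comment> \<open>Numerically, 1.498^2 + 2 * 0.619^2 = 3.0103..., just above 3.\<close>
    ultimately have "(1498 / 1000)\<^sup>2 * P\<^sup>2 + 2 * ((619 / 1000)\<^sup>2 * P\<^sup>2) \<le> 3 * P\<^sup>2"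
      unfolding power_mult_distrib by linarith
    moreover have "P\<^sup>2 > 0" using P by simp
    ultimately show False by (simp add: power2_eq_square)
  qed
  have lam': "624 / 1000 * P \<le> c" "c \<le> P" using lam by (simp_all add: P_def)
  \<comment> \<open>Index 0 lies beyond \<open>c\<close>, with modulus at least
    \<open>1.499 * P\<close> against \<open>c \<le> P\<close>. The indices from 2 on have modulus
    below \<open>0.62 * P\<close>, and \<open>0.624 - 0.62 = 1 / 250\<close> is the claimed
    gap.\<close>
  consider "a = 0" | "a \<ge> 2" using a by linarith
  hence "P / 250 \<le> \<bar>l a - c\<bar>"
  proof cases
    case 1
    show ?thesis using l0 lam' P unfolding 1 by linarith
  next
    case 2
    hence "\<bar>l a\<bar> \<le> \<bar>l 2\<bar>" using sorted[of 2 a] a by (cases "a = 2") auto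
    thus ?thesis using l2 lam' P by linarith
  qed
  thus ?thesis by (simp add: P_def)
qed

text \<open>A Davis-Kahan argument. The vector \<open>v\<close> is an approximate eigenvector of
  \<open>A\<close> with residual at most \<open>e\<close>, so by the gap nearly all of its weight
  lies on \<open>f 1\<close>. The eigenvalue \<open>l 1\<close> is isolated, so \<open>y\<close> is
  \<open>f 1\<close> up to sign, and \<open>yv\<close> selects the sign.\<close>

lemma second_eigenvector_close:
  assumes n: "n = 2 * s" "s \<ge> 3000" and p: "p > 0"
    and noise: "\<And>x y. \<bar>bilin n (\<lambda>i j. A i j - band_prob p s i j) x y\<bar> \<le> e * sqrt (sqnorm n x) * sqrt (sqnorm n y)"
    and e: "0 \<le> e" "e \<le> p * real s / 4000"
    and sorted: "\<And>a b. a < b \<Longrightarrow> b < n \<Longrightarrow> \<bar>l b\<bar> \<le> \<bar>l a\<bar>"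
    and lam: "624 / 1000 * (p * real s) \<le> c" "c \<le> p * real s"
    and v: "\<And>i. i < n \<Longrightarrow> mat_apply n (band_prob p s) v i = c * v i" "sqnorm n v = 1"
    and y: "\<And>i. i < n \<Longrightarrow> mat_apply n A y i = l 1 * y i" "sqnorm n y = 1"
    and yv: "dot n y v \<ge> 0"
  shows "sqnorm n (\<lambda>i. y i - v i) \<le> 2 * (250 * e / (p * real s))\<^sup>2"
proof -
  define P where "P = p * real s"
  have P: "P > 0" using p n by (simp add: P_def)
  have gap: "(P / 250)\<^sup>2 \<le> (l a - c)\<^sup>2" if "a < n" "a \<noteq> 1" for a
    using eigenvalue_gap[OF n p noise e sorted lam that] P
    by (subst abs_le_square_iff[symmetric]) (simp add: P_def)
  have "sqnorm n (\<lambda>i. mat_apply n A v i - c * v i)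
      = sqnorm n (mat_apply n (\<lambda>i j. A i j - band_prob p s i j) v)"
    by (intro sqnorm_cong) (simp add: v(1)[symmetric], simp add: mat_apply_def left_diff_distrib sum_subtractf)
  also have "\<dots> \<le> e\<^sup>2"
    using sqnorm_mat_apply_le[OF noise, of v] v(2) by (simp add: sqrt_le_D)
  finally have res: "(\<Sum>a<n. (l a - c)\<^sup>2 * (dot n v (f a))\<^sup>2) \<le> e\<^sup>2"
    by (simp add: sqnorm_residual)
  have one: "1 \<in> {..<n}" using n by simp
  have off: "(\<Sum>a\<in>{..<n} - {1}. (dot n v (f a))\<^sup>2) \<le> (250 * e / P)\<^sup>2"
  proof -
    have "(P / 250)\<^sup>2 * (\<Sum>a\<in>{..<n} - {1}. (dot n v (f a))\<^sup>2)
        \<le> (\<Sum>a\<in>{..<n} - {1}. (l a - c)\<^sup>2 * (dot n v (f a))\<^sup>2)"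
      unfolding sum_distrib_left using gap by (intro sum_mono mult_right_mono) auto
    also have "\<dots> \<le> (\<Sum>a<n. (l a - c)\<^sup>2 * (dot n v (f a))\<^sup>2)"
      by (intro sum_mono2) auto
    also note res
    finally show ?thesis using P by (simp add: field_simps power_divide power_mult_distrib)
  qed
  \<comment> \<open>If \<open>l 1\<close> were far from \<open>c\<close> as well, every eigenvalue
    would be, and the unit vector \<open>v\<close> would have residual at least
    \<open>P / 250\<close>, far above \<open>e\<close>.\<close>
  have l1: "(l 1 - c)\<^sup>2 < (P / 250)\<^sup>2"
  proof (rule ccontr)
    assume "\<not> ?thesis"
    with gap have "(P / 250)\<^sup>2 \<le> (l a - c)\<^sup>2" if "a < n" for a
      using that by (cases "a = 1") auto
    hence "(\<Sum>a<n. (P / 250)\<^sup>2 * (dot n v (f a))\<^sup>2) \<le> e\<^sup>2"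
      by (intro order_trans[OF _ res] sum_mono mult_right_mono) auto
    hence "(P / 250)\<^sup>2 \<le> e\<^sup>2" by (simp add: sum_distrib_left[symmetric] parseval v(2))
    hence "P / 250 \<le> e" using e(1) by (rule power2_le_imp_le)
    thus False using e(2) P by (simp add: P_def)
  qed
  \<comment> \<open>The residual of \<open>y\<close> at \<open>l 1\<close> is zero, and no other
    \<open>l a\<close> equals \<open>l 1\<close>, because only \<open>l 1\<close> is closer to
    \<open>c\<close> than the gap.\<close>
  have yf: "dot n y (f a) = 0" if "a < n" "a \<noteq> 1" for a
  proof -
    have "sqnorm n (\<lambda>i. mat_apply n A y i - l 1 * y i) = sqnorm n (\<lambda>_. 0)"
      by (intro sqnorm_cong) (simp add: y(1))
    hence "(\<Sum>a<n. (l a - l 1)\<^sup>2 * (dot n y (f a))\<^sup>2) = 0"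
      unfolding sqnorm_residual by (simp add: sqnorm_def)
    hence "(l a - l 1)\<^sup>2 * (dot n y (f a))\<^sup>2 = 0"
      using that by (subst (asm) sum_nonneg_eq_0_iff) auto
    moreover have "l a \<noteq> l 1" using gap[OF that] l1 by auto
    ultimately show ?thesis by simp
  qed
  have sum1: "(\<Sum>a<n. g a) = g 1 + (\<Sum>a\<in>{..<n} - {1}. g a)" for g :: "nat \<Rightarrow> real"
    using one by (subst sum.remove[of _ 1]) auto
  have "(dot n y (f 1))\<^sup>2 = 1"
    using parseval[of y] y(2) yf by (simp add: sum1)
  moreover have "dot n y v = dot n y (f 1) * dot n v (f 1)"
    using parseval_dot[of y v] yf by (simp add: sum1)
  ultimately have "(dot n y v)\<^sup>2 = (dot n v (f 1))\<^sup>2" by (simp add: power_mult_distrib)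
  moreover have "(dot n v (f 1))\<^sup>2 + (\<Sum>a\<in>{..<n} - {1}. (dot n v (f a))\<^sup>2) = 1"
    using parseval[of v] v(2) by (simp add: sum1)
  moreover have "(\<Sum>a\<in>{..<n} - {1}. (dot n v (f a))\<^sup>2) \<ge> 0" by (intro sum_nonneg) auto
  ultimately have d2: "1 - (250 * e / P)\<^sup>2 \<le> (dot n y v)\<^sup>2" "(dot n y v)\<^sup>2 \<le> 1"
    using off by linarith+
  have "\<bar>dot n y v\<bar> \<le> 1" using d2(2) by (simp only: abs_square_le_1)
  hence "dot n y v \<le> 1" by simp
  \<comment> \<open>The squared distance is \<open>2 - 2 * dot n y v\<close>. Since the inner
    product lies between 0 and 1, replacing it by its square only increases this expression.\<close>
  hence "(dot n y v)\<^sup>2 \<le> dot n y v"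
    using yv mult_left_le[of "dot n y v" "dot n y v"] by (simp add: power2_eq_square)
  moreover have "sqnorm n (\<lambda>i. y i - v i) = sqnorm n y + sqnorm n v - 2 * dot n y v"
    by (simp add: sqnorm_def dot_def power2_diff sum.distrib sum_subtractf sum_distrib_left mult_ac)
  ultimately show ?thesis using d2(1) y(2) v(2) unfolding P_def by linarith
qed

end

section \<open>Counting inversions\<close>

text \<open>The difference is \<open>2 * sin m * sin d\<close> with midpoint \<open>m\<close> and
  half-distance \<open>d\<close>. Because \<open>d \<le> m \<le> pi - d\<close>, the first sine is
  at least the second, and Jordan's inequality bounds both. The quadratic order is sharp near 0 and
  \<open>pi\<close>, where the cosine is flat.\<close>

lemma cos_diff_ge:
  fixes a b :: real
  assumes "0 \<le> a" "a \<le> b" "b \<le> pi"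
  shows "cos a - cos b \<ge> 2 * ((b - a) / pi)\<^sup>2"
proof -
  define m d where "m = (a + b) / 2" and "d = (b - a) / 2"
  have d: "0 \<le> d" "d \<le> pi / 2" "d \<le> m" "m \<le> pi - d"
    using assms by (auto simp: m_def d_def field_simps)
  have "sin d \<le> sin m"
  proof (cases "m \<le> pi / 2")
    case True
    thus ?thesis using d by (intro sin_monotone_2pi_le) auto
  next
    case False
    hence "sin d \<le> sin (pi - m)" using d by (intro sin_monotone_2pi_le) auto
    thus ?thesis by simp
  qed
  moreover have sd: "2 * d / pi \<le> sin d" by (rule two_div_pi_le_sin) (use d in auto)
  moreover have "0 \<le> 2 * d / pi" using d by simp
  ultimately have "(2 * d / pi) * (2 * d / pi) \<le> sin m * sin d"
    by (intro mult_mono) auto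
  moreover have "cos a - cos b = 2 * (sin m * sin d)"
    using cos_diff_cos[of a b] by (simp add: m_def d_def)
  moreover have "b - a = 2 * d" by (simp add: d_def)
  ultimately show ?thesis by (simp only: power2_eq_square)
qed

lemma u_fun_gap:
  assumes "i < j" "j < 2 * s" "0 \<le> k" "k \<le> real j - real i"
  shows "u_fun s i - u_fun s j \<ge> k\<^sup>2 / (2 * (real (2 * s))\<^sup>2)"
proof -
  define \<theta> where "\<theta> = pi / (4 * real s + 2)"
  define \<phi> where "\<phi> i = real (if i < s then 2 * i + 1 else 2 * i + 3) * \<theta>" for i
  have s: "s \<ge> 1" using assms by simp
  have \<theta>: "\<theta> > 0" "(4 * real s + 2) * \<theta> = pi"
    using s by (auto simp: \<theta>_def field_simps intro: add_pos_nonneg)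
  have gap: "2 * (real j - real i) * \<theta> \<le> \<phi> j - \<phi> i"
  proof -
    have "2 * (real j - real i) \<le> real (if j < s then 2 * j + 1 else 2 * j + 3) - real (if i < s then 2 * i + 1 else 2 * i + 3)"
      using assms(1) by auto
    thus ?thesis using \<theta>(1) unfolding \<phi>_def left_diff_distrib[symmetric] by (intro mult_right_mono) auto
  qed
  have "0 \<le> \<phi> i" using \<theta> by (simp add: \<phi>_def)
  moreover have "\<phi> i \<le> \<phi> j" using gap assms(1) \<theta>(1) by (smt (verit) mult_nonneg_nonneg of_nat_less_iff)
  moreover have "\<phi> j \<le> pi"
  proof -
    have "real (if j < s then 2 * j + 1 else 2 * j + 3) \<le> 4 * real s + 2"
      using assms(2) by auto
    thus ?thesis unfolding \<phi>_def \<theta>(2)[symmetric] using \<theta>(1) by (intro mult_right_mono) auto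
  qed
  ultimately have "2 * ((\<phi> j - \<phi> i) / pi)\<^sup>2 \<le> cos (\<phi> i) - cos (\<phi> j)"
    by (rule cos_diff_ge)
  also have "cos (\<phi> i) - cos (\<phi> j) = u_fun s i - u_fun s j"
    by (simp add: u_fun_def \<phi>_def \<theta>_def)
  finally have main: "2 * ((\<phi> j - \<phi> i) / pi)\<^sup>2 \<le> u_fun s i - u_fun s j" .
  have "k / (2 * real (2 * s)) \<le> (\<phi> j - \<phi> i) / pi"
  proof -
    \<comment> \<open>The angles of \<open>i\<close> and \<open>j\<close> differ by at least
      \<open>2 * k\<close> steps of \<theta>, as the omitted angle only widens the gap; relative to
      \<open>pi\<close> this is \<open>k / (2 * s + 1)\<close>, and
      \<open>2 * s + 1 \<le> 4 * s\<close>.\<close>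
    have "k / (2 * real (2 * s)) \<le> k / (2 * real s + 1)"
      using assms(3) s by (intro divide_left_mono mult_pos_pos) auto
    also have "\<dots> = 2 * k * \<theta> / pi"
    proof -
      define D where "D = 2 * real s + 1"
      have "\<theta> = pi / (2 * D)" "D > 0" by (simp_all add: \<theta>_def D_def)
      thus ?thesis unfolding D_def[symmetric] by simp
    qed
    also have "\<dots> \<le> 2 * (real j - real i) * \<theta> / pi"
      using assms(4) \<theta>(1) by (intro divide_right_mono mult_right_mono) auto
    also have "\<dots> \<le> (\<phi> j - \<phi> i) / pi"
      using gap by (intro divide_right_mono) auto
    finally show ?thesis .
  qed
  hence "(k / (2 * real (2 * s)))\<^sup>2 \<le> ((\<phi> j - \<phi> i) / pi)\<^sup>2"
    using assms(3) by (intro power_mono) auto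
  hence "2 * (k / (2 * real (2 * s)))\<^sup>2 \<le> u_fun s i - u_fun s j"
    using main by linarith
  thus ?thesis by (simp add: power_divide power_mult_distrib)
qed

text \<open>An inversion of \<open>y\<close> must overcome a gap \<open>g\<close> of
  \<open>v\<close>, so one of its two indices deviates by at least \<open>g / 2\<close>. Chebyshev's
  inequality bounds the number of such indices, and each belongs to at most \<open>2 * n\<close>
  pairs.\<close>

lemma kendall_refined_le:
  assumes y: "y \<in> carrier_vec n" and g: "g > 0"
    and gap: "\<And>i j. i < j \<Longrightarrow> j < n \<Longrightarrow> k \<le> real j - real i \<Longrightarrow> g \<le> v i - v j" and k: "k > 0"
  shows "real (kendall_refined k r y) \<le> 8 * real n * sqnorm n (\<lambda>i. y $ i - v i) / g\<^sup>2"
proof -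
  define z where "z i = y $ i - v i" for i
  define B where "B = {i \<in> {1..n}. g / 2 \<le> \<bar>z (i - 1)\<bar>}"
  have fB: "finite B" by (simp add: B_def)
  have sub: "{(i, j). i \<in> {1..dim_vec y} \<and> j \<in> {1..dim_vec y} \<and>
      y $ (j - 1) > y $ (i - 1) \<and> real i + k \<le> real j \<and> r \<le> real i} \<subseteq> B \<times> {1..n} \<union> {1..n} \<times> B"
  proof (clarify)
    fix i j assume ij: "i \<in> {1..dim_vec y}" "j \<in> {1..dim_vec y}" "y $ (j - 1) > y $ (i - 1)" "real i + k \<le> real j"
      and nB: "\<not> (i \<in> {1..n} \<and> j \<in> B)"
    have "i < j" using ij(4) k by linarith
    hence "g \<le> v (i - 1) - v (j - 1)"
      using ij y by (intro gap) (auto simp: of_nat_diff)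
    hence "g \<le> \<bar>z (i - 1)\<bar> + \<bar>z (j - 1)\<bar>" using ij(3) unfolding z_def by linarith
    hence "g / 2 \<le> \<bar>z (i - 1)\<bar> \<or> g / 2 \<le> \<bar>z (j - 1)\<bar>" by linarith
    thus "i \<in> B \<and> j \<in> {1..n}" using ij y nB by (auto simp: B_def)
  qed
  have "kendall_refined k r y \<le> card (B \<times> {1..n} \<union> {1..n} \<times> B)"
    unfolding kendall_refined_def by (rule card_mono[OF _ sub]) (simp add: fB)
  also have "\<dots> \<le> card (B \<times> {1..n}) + card ({1..n} \<times> B)" by (rule card_Un_le)
  also have "\<dots> = 2 * n * card B" by (simp add: card_cartesian_product)
  finally have "real (kendall_refined k r y) \<le> real (2 * n * card B)" by (simp only: of_nat_le_iff)
  hence 1: "real (kendall_refined k r y) \<le> 2 * real n * real (card B)" by simp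
  have "real (card B) * (g / 2)\<^sup>2 = (\<Sum>i\<in>B. (g / 2)\<^sup>2)" by simp
  also have "\<dots> \<le> (\<Sum>i\<in>B. (z (i - 1))\<^sup>2)"
    using g by (intro sum_mono) (auto simp: B_def abs_le_square_iff[symmetric])
  also have "\<dots> \<le> (\<Sum>i\<in>{1..n}. (z (i - 1))\<^sup>2)"
    by (intro sum_mono2) (auto simp: B_def)
  also have "\<dots> = sqnorm n z"
    unfolding sqnorm_def by (rule sum.reindex_bij_witness[of _ Suc "\<lambda>i. i - 1"]) auto
  finally have "real (card B) \<le> 4 * sqnorm n z / g\<^sup>2"
    using g by (simp add: field_simps power2_eq_square)
  hence "2 * real n * real (card B) \<le> 2 * real n * (4 * sqnorm n z / g\<^sup>2)"
    by (intro mult_left_mono) auto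
  with 1 show ?thesis unfolding z_def by simp
qed

text \<open>The trivial bound, which settles the small values of \<open>n\<close>.\<close>

lemma kendall_refined_le_square:
  assumes "y \<in> carrier_vec n"
  shows "real (kendall_refined k r y) \<le> (real n)\<^sup>2"
proof -
  have "kendall_refined k r y \<le> card ({1..n} \<times> {1..n})"
    unfolding kendall_refined_def using assms by (intro card_mono) auto
  hence "real (kendall_refined k r y) \<le> real (n * n)"
    by (simp only: card_cartesian_product card_atLeastAtMost of_nat_le_iff) simp
  thus ?thesis by (simp add: power2_eq_square)
qed

text \<open>Jordan's inequality bounds the sine from below and hence \<open>c\<close> from above.
  From \<open>sin x \<le> x\<close> and \<open>pi < 16 / 5\<close> the coefficient of
  \<open>s\<close> is at least \<open>4 * 5 / 32 = 0.625\<close>; lowering it to 0.624 pays for the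
  -1 once \<open>s \<ge> 1000\<close>.\<close>

lemma lambda_bounds:
  assumes "p > 0" "s \<ge> 1000"
  defines "c \<equiv> p * (1 / (2 * sin (pi / (4 * real s + 2))) - 1)"
  shows "624 / 1000 * (p * real s) \<le> c" "c \<le> p * real s"
proof -
  define \<theta> where "\<theta> = pi / (4 * real s + 2)"
  have \<theta>: "0 < \<theta>" "\<theta> \<le> pi / 2"
    unfolding \<theta>_def by (simp add: add_nonneg_pos, intro divide_left_mono) (auto simp: add_nonneg_pos)
  have low: "1 / (2 * real s + 1) \<le> sin \<theta>"
  proof -
    define D where "D = 2 * real s + 1"
    have "\<theta> = pi / (2 * D)" "D > 0" by (simp_all add: \<theta>_def D_def)
    hence "1 / (2 * real s + 1) = 2 * \<theta> / pi" unfolding D_def[symmetric] by simp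
    thus ?thesis using two_div_pi_le_sin[of \<theta>] \<theta> by simp
  qed
  have sin_pos: "sin \<theta> > 0" by (rule order_less_le_trans[OF _ low]) simp
  have "1 / (2 * sin \<theta>) \<le> real s + 1 / 2"
    using low sin_pos by (simp add: field_simps)
  hence "1 / (2 * sin \<theta>) - 1 \<le> real s" by simp
  thus "c \<le> p * real s" unfolding c_def \<theta>_def[symmetric] using assms(1) by (intro mult_left_mono) auto
  have "sin \<theta> \<le> \<theta>" using \<theta> by (intro sin_x_le_x) auto
  also have "\<theta> \<le> (16 / 5) / (4 * real s + 2)"
    unfolding \<theta>_def using pi_less_16_div_5 by (intro divide_right_mono) auto
  finally have "sin \<theta> * (4 * real s + 2) \<le> 16 / 5" by (simp add: field_simps)
  hence "(4 * real s + 2) * (5 / 32) \<le> 1 / (2 * sin \<theta>)"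
    using sin_pos by (simp add: field_simps)
  hence "624 / 1000 * real s \<le> 1 / (2 * sin \<theta>) - 1" using assms(2) by simp
  hence "p * (624 / 1000 * real s) \<le> c"
    unfolding c_def \<theta>_def[symmetric] using assms(1) by (intro mult_left_mono) auto
  thus "624 / 1000 * (p * real s) \<le> c" by simp
qed

section \<open>From the noise bound to the inversion count\<close>

lemma sqnorm_u_fun:
  assumes "s \<ge> 1"
  shows "0 < sqnorm (2 * s) (u_fun s)" "sqnorm (2 * s) (u_fun s) \<le> real (2 * s)"
proof -
  have "pi / (4 * real s + 2) < pi / 2"
    using assms by (intro divide_strict_left_mono) (auto simp: add_nonneg_pos)
  hence "0 < u_fun s 0"
    using assms unfolding u_fun_def by (intro cos_gt_zero) (auto simp: add_nonneg_pos)
  hence "0 < (u_fun s 0)\<^sup>2" by simp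
  also have "\<dots> \<le> sqnorm (2 * s) (u_fun s)"
    unfolding sqnorm_def using assms by (intro member_le_sum) auto
  finally show "0 < sqnorm (2 * s) (u_fun s)" .
  have "sqnorm (2 * s) (u_fun s) \<le> (\<Sum>i<2 * s. 1)"
    unfolding sqnorm_def u_fun_def by (intro sum_mono) (auto simp: abs_square_le_1)
  thus "sqnorm (2 * s) (u_fun s) \<le> real (2 * s)" by simp
qed

lemma kendall_refined_second_eigenvector:
  fixes y :: "real vec"
  assumes p: "p > 0" and n: "n = 2 * s" "s \<ge> 3000" and k: "k > 0"
    and e: "e = 2 * sqrt (40 * real n)" "e \<le> p * real s / 4000"
    and noise: "\<And>x y. \<bar>bilin n (noise p s b) x y\<bar> \<le> e * sqrt (sqnorm n x) * sqrt (sqnorm n y)"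
    and lam: "is_lambda2 (sym_matrix n b) \<mu>" and ev: "eigenvector (sym_matrix n b) y \<mu>"
    and y: "y \<bullet> y = 1" "y \<bullet> u_vec s \<ge> 0"
  shows "real (kendall_refined k r y) \<le> 2560000000 / p\<^sup>2 * (real n ^ 5 / k ^ 4)"
proof -
  define A where "A = sym_matrix n b"
  have A: "A \<in> carrier_mat n n" by (simp add: A_def sym_matrix_def)
  have symA: "transpose_mat A = A" by (rule eq_matI) (auto simp: A_def sym_matrix_def)
  obtain ls where ls: "char_poly A = (\<Prod>a\<leftarrow>ls. [:-a, 1:])"
    "sorted_wrt (\<lambda>a b. \<bar>a\<bar> \<ge> \<bar>b\<bar>) ls" "ls ! 1 = \<mu>"
    using lam unfolding is_lambda2_def A_def by auto
  obtain f where f: "eigenbasis n (\<lambda>i j. A $$ (i, j)) f (\<lambda>a. ls ! a)" and len: "length ls = n"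
    using eigenbasis_of_char_poly[OF A symA ls(1)] .
  interpret eigenbasis n "\<lambda>i j. A $$ (i, j)" f "\<lambda>a. ls ! a" by (rule f)
  have yc: "y \<in> carrier_vec n" and Ay: "A *\<^sub>v y = \<mu> \<cdot>\<^sub>v y"
    using ev A unfolding eigenvector_def A_def[symmetric] by auto
  have s1: "s \<ge> 1" using n by simp
  note U = sqnorm_u_fun[OF s1, folded n(1)]
  define v where "v i = (1 / sqrt (sqnorm n (u_fun s))) * u_fun s i" for i
  define c where "c = p * (1 / (2 * sin (pi / (4 * real s + 2))) - 1)"
  define H where "H = sqnorm n (\<lambda>i. y $ i - v i)"
  have H: "H \<le> 2 * (250 * e / (p * real s))\<^sup>2"
    unfolding H_def
  proof (rule second_eigenvector_close[OF n p])
    show "\<bar>bilin n (\<lambda>i j. A $$ (i, j) - band_prob p s i j) x y\<bar> \<le> e * sqrt (sqnorm n x) * sqrt (sqnorm n y)" for x y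
      using noise[of x y] unfolding noise_def[abs_def] A_def n(1) .
    show "0 \<le> e" "e \<le> p * real s / 4000" using e by auto
    show "\<bar>ls ! b\<bar> \<le> \<bar>ls ! a\<bar>" if "a < b" "b < n" for a b
      using sorted_wrt_nth_less[OF ls(2) that(1)] that(2) len by simp
    show "624 / 1000 * (p * real s) \<le> c" "c \<le> p * real s"
      unfolding c_def using lambda_bounds[of p s] p n by auto
    show "mat_apply n (band_prob p s) v i = c * v i" if "i < n" for i
    proof -
      have "mat_apply n (band_prob p s) v i
          = (1 / sqrt (sqnorm n (u_fun s))) * (\<Sum>j<n. band_prob p s i j * u_fun s j)"
        unfolding mat_apply_def v_def sum_distrib_left by (intro sum.cong) auto
      also have "(\<Sum>j<n. band_prob p s i j * u_fun s j) = c * u_fun s i"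
        unfolding c_def n(1) by (rule u_fun_eigenvector) (use that n in simp)
      finally show ?thesis unfolding v_def[of i] by (simp only: mult_ac)
    qed
    show "sqnorm n v = 1"
      unfolding v_def sqnorm_scale using U(1) by (simp add: power_divide)
    show "mat_apply n (\<lambda>i j. A $$ (i, j)) (\<lambda>i. y $ i) i = ls ! 1 * y $ i" if "i < n" for i
    proof -
      have "mat_apply n (\<lambda>i j. A $$ (i, j)) (\<lambda>i. y $ i) i = (A *\<^sub>v y) $ i"
        using that A yc by (simp add: mat_apply_def scalar_prod_def atLeast0LessThan)
      thus ?thesis unfolding Ay ls(3) using that yc by simp
    qed
    show "sqnorm n (\<lambda>i. y $ i) = 1"
      using y(1) yc by (simp add: sqnorm_eq_dot dot_def scalar_prod_def atLeast0LessThan)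
    have "dot n (\<lambda>i. y $ i) v = (1 / sqrt (sqnorm n (u_fun s))) * (y \<bullet> u_vec s)"
    proof -
      have "y \<bullet> u_vec s = (\<Sum>i<n. y $ i * u_fun s i)"
      proof -
        have "dim_vec (u_vec s) = n" by (simp add: u_vec_def n(1))
        thus ?thesis
          unfolding scalar_prod_def atLeast0LessThan by (intro sum.cong) (auto simp: n(1) u_vec_eq)
      qed
      thus ?thesis unfolding dot_def v_def by (simp add: sum_distrib_left mult_ac)
    qed
    thus "dot n (\<lambda>i. y $ i) v \<ge> 0" using y(2) U(1) by simp
  qed
  \<comment> \<open>Normalizing \<open>u\<close> divides its gaps by its norm, which is at most
    \<open>sqrt n\<close>.\<close>
  define g where "g = k\<^sup>2 / (2 * (real n)\<^sup>2) / sqrt (real n)"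
  have n0: "real n > 0" using n by simp
  have g: "g > 0" using k n0 by (simp add: g_def)
  have "real (kendall_refined k r y) \<le> 8 * real n * H / g\<^sup>2"
    unfolding H_def
  proof (rule kendall_refined_le[OF yc g _ k])
    fix i j assume ij: "i < j" "j < n" "k \<le> real j - real i"
    have gap: "k\<^sup>2 / (2 * (real n)\<^sup>2) \<le> u_fun s i - u_fun s j"
      using u_fun_gap[of i j s k] ij k n by simp
    moreover have "0 \<le> u_fun s i - u_fun s j" by (rule order_trans[OF _ gap]) simp
    ultimately have "g \<le> (u_fun s i - u_fun s j) / sqrt (sqnorm n (u_fun s))"
      unfolding g_def using U n0 by (intro frac_le) auto
    thus "g \<le> v i - v j" by (simp add: v_def diff_divide_distrib)
  qed
  also have "\<dots> \<le> 8 * real n * (2 * (250 * e / (p * real s))\<^sup>2) / g\<^sup>2"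
    using H by (intro divide_right_mono mult_left_mono) auto
  \<comment> \<open>Here \<open>e^2 = 160 * n\<close> and \<open>s = n / 2\<close>, so the constant
    is \<open>62500 * 160 * 4\<close>.\<close>
  also have "(250 * e / (p * real s))\<^sup>2 = 40000000 / (p\<^sup>2 * real n)"
    using p n unfolding e(1) n(1) by (simp add: power_divide power_mult_distrib field_simps power2_eq_square)
  also have "g\<^sup>2 = k ^ 4 / (4 * real n ^ 5)"
    unfolding g_def using n0 by (simp add: power_divide power_mult_distrib field_simps eval_nat_numeral)
  also have "8 * real n * (2 * (40000000 / (p\<^sup>2 * real n))) / (k ^ 4 / (4 * real n ^ 5))
      = 2560000000 / p\<^sup>2 * (real n ^ 5 / k ^ 4)"
    using n0 p k by (simp add: field_simps)
  finally show ?thesis .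
qed

theorem theorem2:
  fixes p \<alpha> \<beta> :: real
  assumes "0 < p" "p < 1" "0 \<le> \<alpha>" "0 \<le> \<beta>"
  shows "\<exists>C > 0. \<forall>s :: nat. s \<ge> 1 \<longrightarrow>
    (let n = 2 * s; r = real n powr \<alpha>; k = real n powr \<beta> in
      measure_pmf.prob (entries_pmf p s)
        {b. \<forall>\<mu> y. is_lambda2 (sym_matrix n b) \<mu> \<and> eigenvector (sym_matrix n b) y \<mu> \<and>
                  y \<bullet> y = 1 \<and> y \<bullet> u_vec s \<ge> 0 \<longrightarrow>
              (if \<alpha> \<le> \<beta> then real (kendall_refined k r y) < C * real n powr (5 - 2 * (\<alpha> + \<beta>))
               else real (kendall_refined k r y) < C * real n powr (5 - 4 * \<beta>))}
      \<ge> 1 - real n powr (-3))"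
proof -
  \<comment> \<open>The 3000 serves the numerical gap estimates. The second summand is chosen so
    that \<open>80 * s \<le> (p * s / 8000)^2\<close>, which is the condition
    \<open>e \<le> p * s / 4000\<close>.\<close>
  define S where "S = 3000 + 5120000000 / p\<^sup>2"
  \<comment> \<open>The first summand serves large \<open>s\<close>, the second bounds
    \<open>k ^ 4\<close> for \<open>s < S\<close>, and the final 1 makes the inequality
    strict.\<close>
  define C where "C = 2560000000 / p\<^sup>2 + (2 * S) powr (4 * \<beta>) + 1"
  have S0: "S > 0" using assms by (simp add: S_def add_pos_nonneg)
  have C0: "C > 0" unfolding C_def using assms by (intro add_nonneg_pos add_nonneg_nonneg) auto
  \<comment> \<open>For \<alpha> \<le> \<beta> the exponent
    \<open>5 - 2 * (\<alpha> + \<beta>)\<close> is at least \<open>5 - 4 * \<beta>\<close>, so one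
    bound covers both cases.\<close>
  have reduce: "if \<alpha> \<le> \<beta> then d < C * real n powr (5 - 2 * (\<alpha> + \<beta>)) else d < C * real n powr (5 - 4 * \<beta>)"
    if "d \<le> (C - 1) * real n powr (5 - 4 * \<beta>)" "n \<ge> 1" for d n
  proof -
    have "(C - 1) * real n powr (5 - 4 * \<beta>) < C * real n powr (5 - 4 * \<beta>)"
      using that(2) by (intro mult_strict_right_mono) auto
    hence *: "d < C * real n powr (5 - 4 * \<beta>)" using that(1) by linarith
    have "C * real n powr (5 - 4 * \<beta>) \<le> C * real n powr (5 - 2 * (\<alpha> + \<beta>))" if "\<alpha> \<le> \<beta>"
      using that \<open>n \<ge> 1\<close> C0 by (intro mult_left_mono powr_mono) auto
    with * show ?thesis by auto
  qed
  show ?thesis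
  proof (intro exI[of _ C] conjI C0 allI impI)
    fix s :: nat assume s: "s \<ge> 1"
    define n where "n = 2 * s"
    define k where "k = real n powr \<beta>"
    define r where "r = real n powr \<alpha>"
    have n1: "n \<ge> 1" "real n > 0" using s by (simp_all add: n_def)
    have k0: "k > 0" using n1 by (simp add: k_def)
    have k4: "k ^ 4 = real n powr (4 * \<beta>)"
      using n1 by (simp add: k_def powr_power mult.commute)
    have n5: "real n ^ 5 = real n powr 5" using n1 by (simp add: powr_numeral)
    have n5k4: "real n ^ 5 / k ^ 4 = real n powr (5 - 4 * \<beta>)"
      unfolding k4 n5 by (simp add: powr_diff)
    define F where "F = {b. \<forall>\<mu> y. is_lambda2 (sym_matrix n b) \<mu> \<and> eigenvector (sym_matrix n b) y \<mu> \<and>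
                  y \<bullet> y = 1 \<and> y \<bullet> u_vec s \<ge> 0 \<longrightarrow>
              (if \<alpha> \<le> \<beta> then real (kendall_refined k r y) < C * real n powr (5 - 2 * (\<alpha> + \<beta>))
               else real (kendall_refined k r y) < C * real n powr (5 - 4 * \<beta>))}"
    have "1 - 1 / real n ^ 3 \<le> measure_pmf.prob (entries_pmf p s) F"
    proof (cases "real s \<ge> S")
      case True
      define e where "e = 2 * sqrt (40 * real n)"
      define G where "G = {b. \<forall>x y. \<bar>bilin n (noise p s b) x y\<bar> \<le> e * sqrt (sqnorm n x) * sqrt (sqnorm n y)}"
      have s3000: "s \<ge> 3000"
      proof -
        have "3000 \<le> real s" using True assms unfolding S_def by (smt (verit) divide_nonneg_nonneg zero_le_power2)
        thus ?thesis by simp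
      qed
      have e_le: "e \<le> p * real s / 4000"
      proof -
        have "5120000000 / p\<^sup>2 \<le> real s" using True unfolding S_def by linarith
        hence "5120000000 * real s \<le> p\<^sup>2 * real s * real s"
          using assms s by (simp add: field_simps)
        hence "40 * real n \<le> (p * real s / 8000)\<^sup>2"
          by (simp add: n_def power2_eq_square field_simps)
        hence "sqrt (40 * real n) \<le> p * real s / 8000"
          using assms by (intro real_le_lsqrt) auto
        thus ?thesis by (simp add: e_def)
      qed
      have "G \<subseteq> F"
      proof
        fix b assume "b \<in> G"
        hence noise: "\<bar>bilin n (noise p s b) x y\<bar> \<le> e * sqrt (sqnorm n x) * sqrt (sqnorm n y)" for x y
          by (simp add: G_def)
        show "b \<in> F"
          unfolding F_def
        proof (intro CollectI allI impI reduce n1(1), elim conjE)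
          fix \<mu> and y :: "real vec"
          assume "is_lambda2 (sym_matrix n b) \<mu>" "eigenvector (sym_matrix n b) y \<mu>"
            "y \<bullet> y = 1" "y \<bullet> u_vec s \<ge> 0"
          hence "real (kendall_refined k r y) \<le> 2560000000 / p\<^sup>2 * (real n ^ 5 / k ^ 4)"
            by (rule kendall_refined_second_eigenvector[OF assms(1) n_def s3000 k0 e_def e_le noise])
          also have "\<dots> \<le> (C - 1) * real n powr (5 - 4 * \<beta>)"
            unfolding n5k4 by (intro mult_right_mono) (auto simp: C_def)
          finally show "real (kendall_refined k r y) \<le> (C - 1) * real n powr (5 - 4 * \<beta>)" .
        qed
      qed
      hence "measure_pmf.prob (entries_pmf p s) G \<le> measure_pmf.prob (entries_pmf p s) F"
        by (intro measure_pmf.finite_measure_mono) auto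
      moreover have "1 - 1 / real n ^ 3 \<le> measure_pmf.prob (entries_pmf p s) G"
        unfolding G_def e_def n_def by (rule prob_noise_bounded) (use assms s in auto)
      ultimately show ?thesis by linarith
    next
      case False
      \<comment> \<open>For small \<open>s\<close> every outcome is good:
        \<open>n^2 \<le> n^5 = k^4 * n powr (5 - 4 * \<beta>)\<close>, and \<open>k^4\<close> is at
        most a constant included in \<open>C\<close>.\<close>
      have "b \<in> F" for b
        unfolding F_def
      proof (intro CollectI allI impI reduce n1(1), elim conjE)
        fix \<mu> and y :: "real vec"
        assume "eigenvector (sym_matrix n b) y \<mu>"
        hence "y \<in> carrier_vec n" by (simp add: eigenvector_def sym_matrix_def)
        hence "real (kendall_refined k r y) \<le> (real n)\<^sup>2" by (rule kendall_refined_le_square)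
        also have "\<dots> \<le> real n ^ 5" using n1 by (intro power_increasing) auto
        also have "\<dots> = k ^ 4 * real n powr (5 - 4 * \<beta>)"
          unfolding n5k4[symmetric] using k0 by simp
        also have "\<dots> \<le> (C - 1) * real n powr (5 - 4 * \<beta>)"
        proof (intro mult_right_mono)
          have "k ^ 4 \<le> (2 * S) powr (4 * \<beta>)"
            unfolding k4 using False assms by (intro powr_mono2) (auto simp: n_def)
          thus "k ^ 4 \<le> C - 1" by (simp add: C_def add_increasing)
        qed auto
        finally show "real (kendall_refined k r y) \<le> (C - 1) * real n powr (5 - 4 * \<beta>)" .
      qed
      hence "F = UNIV" by auto
      thus ?thesis by simp
    qed
    moreover have "real n powr (-3) = 1 / real n ^ 3"
      using n1 by (simp add: powr_minus powr_numeral inverse_eq_divide)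
    ultimately have "1 - real n powr (-3) \<le> measure_pmf.prob (entries_pmf p s) F" by simp
    thus "let n = 2 * s; r = real n powr \<alpha>; k = real n powr \<beta> in
      measure_pmf.prob (entries_pmf p s)
        {b. \<forall>\<mu> y. is_lambda2 (sym_matrix n b) \<mu> \<and> eigenvector (sym_matrix n b) y \<mu> \<and>
                  y \<bullet> y = 1 \<and> y \<bullet> u_vec s \<ge> 0 \<longrightarrow>
              (if \<alpha> \<le> \<beta> then real (kendall_refined k r y) < C * real n powr (5 - 2 * (\<alpha> + \<beta>))
               else real (kendall_refined k r y) < C * real n powr (5 - 4 * \<beta>))}
      \<ge> 1 - real n powr (-3)"
      unfolding Let_def F_def n_def k_def r_def .
  qed
qed

end
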